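(* Let $X$ be a Peano continuum and let $A = H_1(X)/\mathrm{tor}(H_1(X))$. Let $\mathrm{Div}(A)$ be the maximal divisible subgroup of $A$ and $\mathrm{red}(A)\cong A/\mathrm{Div}(A)$ the reduced part of $A$ (so $A = \mathrm{Div}(A)\oplus \mathrm{red}(A)$ for a reduced subgroup $\mathrm{red}(A)$, unique up to isomorphism). Then $\mathrm{red}(A)$ is either a free abelian group of finite rank or has cardinality $2^{\aleph_0}$.
   Context: A Peano continuum is a path connected, locally path connected, compact metrizable space. $\mathrm{tor}(H_1(X))$ is the torsion subgroup of $H_1(X)$. An abelian group is divisible if every element has an $n$-th root for every positive integer $n$, and reduced if it has no nontrivial divisible subgroup. *)

theory Defs
  imports "HOL-Analysis.Analysis" "HOL-Homology.Homology" "HOL-Algebra.Free_Abelian_Groups"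
begin

definition peano_continuum :: "'a topology \<Rightarrow> bool" where
  "peano_continuum X \<longleftrightarrow> path_connected_space X \<and> locally_path_connected_space X
     \<and> compact_space X \<and> metrizable_space X"

definition torsion_subgroup :: "('a, 'b) monoid_scheme \<Rightarrow> 'a set" where
  "torsion_subgroup G = {x \<in> carrier G. \<exists>n::nat. n > 0 \<and> x [^]\<^bsub>G\<^esub> n = \<one>\<^bsub>G\<^esub>}"

definition divisible_subgroup :: "('a, 'b) monoid_scheme \<Rightarrow> 'a set \<Rightarrow> bool" where
  "divisible_subgroup G D \<longleftrightarrow> subgroup D G \<and>
     (\<forall>x\<in>D. \<forall>n::nat. n > 0 \<longrightarrow> (\<exists>y\<in>D. y [^]\<^bsub>G\<^esub> n = x))"

text \<open>The maximal divisible subgroup: the union (= sum) of all divisible subgroups.\<close>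
definition max_divisible_subgroup :: "('a, 'b) monoid_scheme \<Rightarrow> 'a set" where
  "max_divisible_subgroup G = \<Union>{D. divisible_subgroup G D}"

definition reduced_part :: "('a, 'b) monoid_scheme \<Rightarrow> 'a set monoid" where
  "reduced_part G = G Mod (max_divisible_subgroup G)"

definition free_abelian_finite_rank :: "('a, 'b) monoid_scheme \<Rightarrow> bool" where
  "free_abelian_finite_rank G \<longleftrightarrow> (\<exists>n::nat. G \<cong> free_Abelian_group {..<n})"

end

theory Submission
  imports Defs
begin

text \<open>
Let \<open>R\<close> be the reduced part of \<open>A\<close>. It is torsion-free and \<open>\<Inter>n. n R = 0\<close>.

Suppose that every neighbourhood of some point \<open>x\<close> contains a cycle that is nonzero in \<open>R\<close>. Then there are loops
\<open>l n\<close> at \<open>x\<close>, shrinking to \<open>x\<close>, with nonzero classes \<open>a n\<close>, and integers \<open>k n\<close> such that \<open>a n\<close> is not divisible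
by \<open>k n\<close> in \<open>R\<close>. For a set \<open>S\<close> of naturals the nested infinite concatenations that satisfy
\<open>y n = (l n if n \<in> S) * (y (n + 1)) ^ (k n)\<close> converge to loops, and the class of \<open>y 0\<close> in \<open>R\<close> determines \<open>S\<close>,
because \<open>R\<close> is torsion-free. Hence \<open>R\<close> has at least continuum many elements; it has at most that many since
there are only continuum many singular chains.

Otherwise all sufficiently small cycles vanish in \<open>R\<close>. Subdividing a cycle and completing each of its small
simplices to a loop through base points of a finite cover by small path connected open sets shows
that \<open>R\<close> is finitely generated, hence free of finite rank.
\<close>

section \<open>Torsion-free and reduced abelian groups\<close>

definition torsion_free :: "('a, 'b) monoid_scheme \<Rightarrow> bool" where
  "torsion_free G \<longleftrightarrow> (\<forall>x\<in>carrier G. \<forall>n::nat. 0 < n \<longrightarrow> x [^]\<^bsub>G\<^esub> n = \<one>\<^bsub>G\<^esub> \<longrightarrow> x = \<one>\<^bsub>G\<^esub>)"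

lemma torsion_freeD:
  "\<lbrakk>torsion_free G; x \<in> carrier G; 0 < n; x [^]\<^bsub>G\<^esub> (n::nat) = \<one>\<^bsub>G\<^esub>\<rbrakk> \<Longrightarrow> x = \<one>\<^bsub>G\<^esub>"
  by (auto simp: torsion_free_def)

text \<open>A generating family of minimal size is a basis: elementary changes of generators run the Euclidean
  algorithm on the coefficients of a relation until a single one is left, whose generator is then trivial.\<close>
lemma (in comm_group) finitely_generated_torsion_free_imp_free:
  assumes tf: "torsion_free G"
    and S: "finite S" "S \<subseteq> carrier G" "generate G S = carrier G"
  shows "free_abelian_finite_rank G"
proof -
  \<comment> \<open>A generating family is encoded as an epimorphism from the free abelian group on
    its index set. Index sets inside \<open>'a\<close> suffice, as \<open>S\<close> can index
    itself, and changing generators becomes precomposition with an automorphism of the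
    source.\<close>
  define onto where "onto I \<psi> \<longleftrightarrow> finite I \<and> \<psi> \<in> hom (free_Abelian_group I) G
      \<and> \<psi> ` carrier (free_Abelian_group I) = carrier G" for I :: "'a set" and \<psi>
  have gh: "group_hom (free_Abelian_group I) G \<psi>" if "onto I \<psi>" for I \<psi>
    using that by (simp add: onto_def group_hom_def group_hom_axioms_def)
  have "\<exists>\<psi>. onto S \<psi>"
  proof -
    obtain \<psi> where \<psi>: "\<psi> \<in> hom (free_Abelian_group S) G" "\<And>x. x \<in> S \<Longrightarrow> \<psi> (frag_of x) = x"
      using free_Abelian_group_universal[of "\<lambda>x. x" S] S by auto
    interpret h: group_hom "free_Abelian_group S" G \<psi>
      using \<psi> by (simp add: group_hom_def group_hom_axioms_def)
    have "subgroup (\<psi> ` carrier (free_Abelian_group S)) G"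
      by (rule h.img_is_subgroup)
    moreover have "S \<subseteq> \<psi> ` carrier (free_Abelian_group S)"
    proof
      fix x assume "x \<in> S"
      then have "x = \<psi> (frag_of x)" "frag_of x \<in> carrier (free_Abelian_group S)" using \<psi>(2) by auto
      then show "x \<in> \<psi> ` carrier (free_Abelian_group S)" by (rule image_eqI)
    qed
    ultimately have "carrier G \<subseteq> \<psi> ` carrier (free_Abelian_group S)"
      using generate_subgroup_incl[of S] S(3) by simp
    then show ?thesis using \<psi> S(1) h.hom_closed unfolding onto_def by (intro exI[of _ \<psi>]) auto
  qed
  then have ex: "\<exists>n I \<psi>. onto I \<psi> \<and> card I = n" by blast
  define n where "n = (LEAST n. \<exists>I \<psi>. onto I \<psi> \<and> card I = n)"
  obtain I \<psi>0 where I: "onto I \<psi>0" "card I = n"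
    unfolding n_def using LeastI_ex[OF ex] by blast
  have minimal: "n \<le> card J" if "onto J \<phi>" for J \<phi>
    unfolding n_def by (rule Least_le) (use that in blast)
  have finI: "finite I" using I by (simp add: onto_def)
  let ?F = "free_Abelian_group I"
  \<comment> \<open>Induction on the sum of the absolute values of the coefficients of
    \<open>a\<close>. The epimorphism \<psi> is generalised too, since an elementary change of
    generators alters both the relation and the map.\<close>
  have inj: "a = 0" if "onto I \<psi>" "a \<in> carrier ?F" "\<psi> a = \<one>" for \<psi> a
    using that
  proof (induction "nat (\<Sum>i\<in>I. \<bar>poly_mapping.lookup a i\<bar>)" arbitrary: \<psi> a rule: less_induct)
    case less
    interpret h: group_hom ?F G \<psi> by (rule gh) fact
    show ?case
    proof (rule ccontr)
      assume "a \<noteq> 0"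
      then obtain i where i: "i \<in> Poly_Mapping.keys a" by fastforce
      have ka: "Poly_Mapping.keys a \<subseteq> I" using less.prems by simp
      show False
      proof (cases "Poly_Mapping.keys a \<subseteq> {i}")
        case True
        \<comment> \<open>The relation is now \<open>m\<close> times one generator. By
          torsion-freeness that generator maps to the neutral element, so \<open>I - {i}\<close>
          still generates, against the minimality of \<open>n\<close>.\<close>
        define m where "m = poly_mapping.lookup a i"
        have a: "a = frag_cmul m (frag_of i)"
          using True by (auto intro!: poly_mapping_eqI simp: m_def lookup_single in_keys_iff when_def)
        have iI: "frag_of i \<in> carrier ?F" using i ka by auto
        have m: "m \<noteq> 0" using i by (simp add: m_def in_keys_iff)
        have "\<psi> (frag_of i) [^] m = \<one>"
          using h.hom_int_pow[OF iI, of m] less.prems(3) i ka unfolding a by auto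
        then have "\<psi> (frag_of i) [^] (nat \<bar>m\<bar>) = \<one>"
          using int_pow_neg[of "\<psi> (frag_of i)" m] h.hom_closed[OF iI]
          by (cases "0 \<le> m") (simp_all flip: int_pow_int)
        then have e1: "\<psi> (frag_of i) = \<one>" using torsion_freeD[OF tf] m iI h.hom_closed by (metis zero_less_abs_iff zero_less_nat_eq)
        have "onto (I - {i}) \<psi>"
          unfolding onto_def
        proof (intro conjI)
          show "finite (I - {i})" using finI by simp
          show "\<psi> \<in> hom (free_Abelian_group (I - {i})) G"
          proof (rule homI)
            fix x y
            assume "x \<in> carrier (free_Abelian_group (I - {i}))" "y \<in> carrier (free_Abelian_group (I - {i}))"
            then have xy: "x \<in> carrier ?F" "y \<in> carrier ?F" by auto
            show "\<psi> x \<in> carrier G" using xy by simp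
            show "\<psi> (x \<otimes>\<^bsub>free_Abelian_group (I - {i})\<^esub> y) = \<psi> x \<otimes> \<psi> y"
              using h.hom_mult[OF xy] by simp
          qed
          have "\<psi> c \<in> \<psi> ` carrier (free_Abelian_group (I - {i}))" if "c \<in> carrier ?F" for c
          proof -
            define q where "q = poly_mapping.lookup c i"
            \<comment> \<open>\<open>c'\<close> is \<open>c\<close> with its
              \<open>i\<close>-coordinate erased; the image is unchanged because the erased part
              lies in the kernel.\<close>
            define c' where "c' = c + frag_cmul (-q) (frag_of i)"
            have "Poly_Mapping.keys c' \<subseteq> I - {i}"
            proof
              fix j assume j: "j \<in> Poly_Mapping.keys c'"
              then have "j \<noteq> i" by (auto simp: c'_def lookup_add q_def in_keys_iff)
              moreover have "Poly_Mapping.keys c' \<subseteq> I"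
                unfolding c'_def by (rule order_trans[OF keys_add]) (use that i ka in \<open>auto split: if_splits\<close>)
              ultimately show "j \<in> I - {i}" using j by blast
            qed
            moreover have "\<psi> c' = \<psi> c"
            proof -
              have q: "frag_cmul (-q) (frag_of i) \<in> carrier ?F" using iI by auto
              have "\<psi> (frag_cmul (-q) (frag_of i)) = \<one>"
                using h.hom_int_pow[OF iI, of "-q"] i ka e1 by auto
              then show ?thesis
                using h.hom_mult[OF that q] that unfolding c'_def by simp
            qed
            ultimately show ?thesis by (metis carrier_free_Abelian_group_iff imageI)
          qed
          then have "\<psi> ` carrier ?F \<subseteq> \<psi> ` carrier (free_Abelian_group (I - {i}))"
            by (rule image_subsetI)
          moreover have "\<psi> ` carrier (free_Abelian_group (I - {i})) \<subseteq> \<psi> ` carrier ?F"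
            by (rule image_mono) auto
          moreover have "\<psi> ` carrier ?F = carrier G" using less.prems(1) by (simp add: onto_def)
          ultimately show "\<psi> ` carrier (free_Abelian_group (I - {i})) = carrier G" by simp
        qed
        from minimal[OF this] I(2) finI i ka show False
          by (metis card_Diff1_less_iff not_le subset_iff)
      next
        case False
        then obtain j0 where j0: "j0 \<in> Poly_Mapping.keys a" "j0 \<noteq> i" by blast
        obtain i j where ij: "i \<in> I" "j \<in> I" "i \<noteq> j" "poly_mapping.lookup a i \<noteq> 0"
            "poly_mapping.lookup a j \<noteq> 0" "\<bar>poly_mapping.lookup a j\<bar> \<le> \<bar>poly_mapping.lookup a i\<bar>"
          using i j0 ka by (metis in_keys_iff nle_le subset_iff)
        \<comment> \<open>With this sign, subtracting \<open>s\<close> times the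
          \<open>j\<close>-coefficient from the \<open>i\<close>-coefficient lowers the absolute
          value of the latter by that of the former, which is nonzero.\<close>
        define s where "s = sgn (poly_mapping.lookup a i) * sgn (poly_mapping.lookup a j)"
        \<comment> \<open>Elementary automorphism adding \<open>t\<close> times the
          \<open>j\<close>-coordinate to the \<open>i\<close>-coordinate, with inverse
          \<open>E (-t)\<close>. So \<open>\<psi> \<circ> E s\<close> is again onto and kills the
          smaller relation \<open>E (-s) a\<close>.\<close>
        define E where "E t f = f + frag_cmul (t * poly_mapping.lookup f j) (frag_of i)" for t f
        have E_carr: "E t f \<in> carrier ?F" if "f \<in> carrier ?F" for t f
          using that ij unfolding E_def
          by (auto dest!: subsetD[OF keys_add] split: if_splits)
        have E_inv: "E (-t) (E t f) = f" "E t (E (-t) f) = f" for t f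
          using ij(3) by (auto simp: E_def lookup_add lookup_single when_def intro!: poly_mapping_eqI)
        have E_add: "E t (f + g) = E t f + E t g" for t f g
          by (simp add: E_def lookup_add algebra_simps frag_cmul_distrib)
        have on: "onto I (\<psi> \<circ> E s)"
          unfolding onto_def
        proof (intro conjI finI)
          show "\<psi> \<circ> E s \<in> hom ?F G"
          proof (rule homI)
            fix x y assume xy: "x \<in> carrier ?F" "y \<in> carrier ?F"
            show "(\<psi> \<circ> E s) x \<in> carrier G" using xy E_carr h.hom_closed by simp
            show "(\<psi> \<circ> E s) (x \<otimes>\<^bsub>?F\<^esub> y) = (\<psi> \<circ> E s) x \<otimes> (\<psi> \<circ> E s) y"
              using h.hom_mult[OF E_carr[OF xy(1)] E_carr[OF xy(2)]] E_add by simp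
          qed
          have "E s ` carrier ?F = carrier ?F"
          proof
            show "carrier ?F \<subseteq> E s ` carrier ?F"
              using E_inv(2)[of s] E_carr by (metis image_eqI subsetI)
          qed (use E_carr in blast)
          then show "(\<psi> \<circ> E s) ` carrier ?F = carrier G"
            using less.prems(1) unfolding onto_def image_comp[symmetric] by simp
        qed
        define a' where "a' = E (-s) a"
        have a': "a' \<in> carrier ?F" "(\<psi> \<circ> E s) a' = \<one>"
          using E_carr less.prems E_inv by (auto simp: a'_def)
        have la: "poly_mapping.lookup a' t = (if t = i then poly_mapping.lookup a i - s * poly_mapping.lookup a j
            else poly_mapping.lookup a t)" for t
          by (auto simp: a'_def E_def lookup_add lookup_single when_def)
        have lt: "\<bar>poly_mapping.lookup a i - s * poly_mapping.lookup a j\<bar> < \<bar>poly_mapping.lookup a i\<bar>"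
          using ij(4-6) unfolding s_def by (cases "poly_mapping.lookup a i > 0"; cases "poly_mapping.lookup a j > 0") auto
        have "(\<Sum>i\<in>I. \<bar>poly_mapping.lookup a' i\<bar>) < (\<Sum>i\<in>I. \<bar>poly_mapping.lookup a i\<bar>)"
          by (rule sum_strict_mono_ex1) (use finI ij(1) lt la in auto)
        moreover have "0 \<le> (\<Sum>i\<in>I. \<bar>poly_mapping.lookup a' i\<bar>)" by (simp add: sum_nonneg)
        ultimately have "nat (\<Sum>i\<in>I. \<bar>poly_mapping.lookup a' i\<bar>) < nat (\<Sum>i\<in>I. \<bar>poly_mapping.lookup a i\<bar>)"
          by linarith
        from less.hyps[OF this on a'] have "a' = 0" .
        then have "a = E s 0" using E_inv(2)[of s a] by (simp add: a'_def)
        then have "a = 0" by (simp add: E_def)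
        with \<open>a \<noteq> 0\<close> show False by simp
      qed
    qed
  qed
  interpret h: group_hom ?F G \<psi>0 by (rule gh) fact
  have "\<psi>0 \<in> iso ?F G"
    unfolding h.iso_iff
  proof (intro conjI ballI impI)
    show "carrier G \<subseteq> \<psi>0 ` carrier ?F" using I(1) by (simp add: onto_def)
    show "x = \<one>\<^bsub>?F\<^esub>" if "x \<in> carrier ?F" "\<psi>0 x = \<one>" for x
      using inj[OF I(1) that] by simp
  qed
  then have "G \<cong> ?F" using group.iso_sym[OF group_free_Abelian_group] is_isoI by blast
  also have "?F \<cong> free_Abelian_group {..<n}"
    unfolding isomorphic_free_Abelian_groups using finI I(2) by (simp add: eqpoll_iff_card)
  finally show ?thesis unfolding free_abelian_finite_rank_def by blast
qed

text \<open>The quotient of two \<open>n\<close>-th roots of the same element is torsion.\<close>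

lemma (in comm_group) nat_pow_inj_torsion_free:
  assumes tf: "torsion_free G"
    and "x \<in> carrier G" "y \<in> carrier G" "0 < n" "x [^] (n::nat) = y [^] n"
  shows "x = y"
proof -
  have "(x \<otimes> inv y) [^] n = \<one>"
    using assms by (simp add: nat_pow_distrib nat_pow_inv)
  then have "x \<otimes> inv y = \<one>" using torsion_freeD[OF tf, of "x \<otimes> inv y" n] assms(2-4) by simp
  moreover have "x = (x \<otimes> inv y) \<otimes> y" using assms by (simp add: m_assoc)
  ultimately show ?thesis using assms by simp
qed

text \<open>The relation between consecutive terms makes \<^term>\<open>Y S 0\<close> a mixed-radix expansion with digits
  \<^term>\<open>l n\<close> and radices \<^term>\<open>k n\<close>: at the first digit where two equal expansions differ, \<^term>\<open>l n\<close> would be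
  divisible by \<^term>\<open>k n\<close>.\<close>
lemma (in comm_group) inj_digit_expansion:
  assumes tf: "torsion_free G"
    and l: "\<And>n. l n \<in> carrier G" and k: "\<And>n::nat. (0::nat) < k n"
    and ndiv: "\<And>n. \<not> (\<exists>y\<in>carrier G. y [^] k n = l n)"
    and Y: "\<And>S n. Y S n \<in> carrier G"
    and step: "\<And>S n. Y S n = (if n \<in> S then l n else \<one>) \<otimes> Y S (Suc n) [^] k n"
  shows "inj (\<lambda>S::nat set. Y S 0)"
proof (rule injI, rule ccontr)
  fix S T assume eq: "Y S 0 = Y T 0" and "S \<noteq> T"
  \<comment> \<open>As long as the digits agree they can be cancelled, and uniqueness of roots
    passes the equality on to the next remainder.\<close>
  have agree: "Y S n = Y T n" if "\<And>m. m < n \<Longrightarrow> m \<in> S \<longleftrightarrow> m \<in> T" for n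
    using that
  proof (induction n)
    case (Suc n)
    then have "Y S n = Y T n" "n \<in> S \<longleftrightarrow> n \<in> T" by auto
    then have "Y S (Suc n) [^] k n = Y T (Suc n) [^] k n"
      using step[of S n] step[of T n] Y l by (auto split: if_splits)
    then show ?case using nat_pow_inj_torsion_free[OF tf Y Y k] by blast
  qed (simp add: eq)
  define N where "N = (LEAST n. (n \<in> S) \<noteq> (n \<in> T))"
  have ex: "\<exists>n. (n \<in> S) \<noteq> (n \<in> T)" using \<open>S \<noteq> T\<close> by blast
  have N: "(N \<in> S) \<noteq> (N \<in> T)" unfolding N_def by (rule LeastI_ex[OF ex])
  have eqN: "Y S N = Y T N"
    by (rule agree) (use not_less_Least in \<open>auto simp: N_def\<close>)
  have no: False if "l N \<otimes> a [^] k N = b [^] k N" "a \<in> carrier G" "b \<in> carrier G" for a b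
  proof -
    have "l N = b [^] k N \<otimes> inv (a [^] k N)" using that l by (simp add: inv_solve_right)
    also have "\<dots> = (b \<otimes> inv a) [^] k N" using that by (simp add: nat_pow_distrib nat_pow_inv)
    finally show False using ndiv[of N] that by (metis inv_closed m_closed)
  qed
  show False
  proof (cases "N \<in> S")
    case True
    then show False using no[of "Y S (Suc N)" "Y T (Suc N)"] N eqN step[of S N] step[of T N] Y by auto
  next
    case False
    then show False using no[of "Y T (Suc N)" "Y S (Suc N)"] N eqN step[of S N] step[of T N] Y by auto
  qed
qed

section \<open>Quotients by the torsion subgroup and by the maximal divisible subgroup\<close>

lemma (in comm_group) comm_group_FactGroup:
  assumes "subgroup N G" shows "comm_group (G Mod N)"
proof -
  interpret N: normal N G using assms by (simp add: normal_iff_subgroup)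
  show ?thesis
  proof (rule group.group_comm_groupI[OF N.factorgroup_is_group])
    fix x y assume "x \<in> carrier (G Mod N)" "y \<in> carrier (G Mod N)"
    then obtain a b where "a \<in> carrier G" "x = N #> a" "b \<in> carrier G" "y = N #> b"
      by (auto simp: carrier_FactGroup)
    then show "x \<otimes>\<^bsub>G Mod N\<^esub> y = y \<otimes>\<^bsub>G Mod N\<^esub> x" by (simp add: N.rcos_sum m_comm)
  qed
qed

lemma (in comm_group) rcoset_hom_FactGroup:
  assumes "subgroup N G"
  shows "(\<lambda>a. N #> a) \<in> hom G (G Mod N)"
    and "(\<lambda>a. N #> a) ` carrier G = carrier (G Mod N)"
    and "a \<in> carrier G \<Longrightarrow> N #> a = \<one>\<^bsub>G Mod N\<^esub> \<longleftrightarrow> a \<in> N"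
proof -
  interpret N: normal N G using assms by (simp add: normal_iff_subgroup)
  show "(\<lambda>a. N #> a) \<in> hom G (G Mod N)" by (rule N.r_coset_hom_Mod)
  show "(\<lambda>a. N #> a) ` carrier G = carrier (G Mod N)" by (simp add: carrier_FactGroup)
  show "N #> a = \<one>\<^bsub>G Mod N\<^esub> \<longleftrightarrow> a \<in> N" if "a \<in> carrier G"
    using that assms by (metis N.is_subgroup coset_join1 coset_join2 one_FactGroup subgroup.subset)
qed

lemma (in comm_group) subgroup_torsion: "subgroup (torsion_subgroup G) G"
proof
  show "torsion_subgroup G \<subseteq> carrier G" by (auto simp: torsion_subgroup_def)
  show "\<one> \<in> torsion_subgroup G" by (auto simp: torsion_subgroup_def)
  show "x \<otimes> y \<in> torsion_subgroup G" if xy: "x \<in> torsion_subgroup G" "y \<in> torsion_subgroup G" for x y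
  proof -
    obtain m n where mn: "x \<in> carrier G" "y \<in> carrier G" "0 < m" "0 < n" "x [^] (m::nat) = \<one>" "y [^] (n::nat) = \<one>"
      using xy by (auto simp: torsion_subgroup_def)
    have "(x \<otimes> y) [^] (m * n) = (x [^] m) [^] n \<otimes> (y [^] n) [^] m"
      using mn(1,2) by (simp add: nat_pow_distrib nat_pow_pow mult.commute)
    then have "(x \<otimes> y) [^] (m * n) = \<one>" using mn by simp
    then show ?thesis using mn unfolding torsion_subgroup_def by (auto intro!: exI[of _ "m * n"])
  qed
  show "inv x \<in> torsion_subgroup G" if "x \<in> torsion_subgroup G" for x
    using that by (auto simp: torsion_subgroup_def nat_pow_inv)
qed

lemma (in comm_group) torsion_free_Mod_torsion: "torsion_free (G Mod torsion_subgroup G)"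
  unfolding torsion_free_def
proof (intro ballI allI impI)
  fix x and n :: nat
  assume assms: "x \<in> carrier (G Mod torsion_subgroup G)" "0 < n"
    "x [^]\<^bsub>G Mod torsion_subgroup G\<^esub> n = \<one>\<^bsub>G Mod torsion_subgroup G\<^esub>"
  let ?T = "torsion_subgroup G"
  interpret A: comm_group "G Mod ?T" by (rule comm_group_FactGroup[OF subgroup_torsion])
  interpret h: group_hom G "G Mod ?T" "\<lambda>a. ?T #> a"
    using rcoset_hom_FactGroup(1)[OF subgroup_torsion] by unfold_locales
  note ker = rcoset_hom_FactGroup(3)[OF subgroup_torsion]
  obtain a where a: "a \<in> carrier G" "x = ?T #> a" using assms(1) by (auto simp: carrier_FactGroup)
  have "?T #> (a [^] n) = \<one>\<^bsub>G Mod ?T\<^esub>" using h.hom_nat_pow[OF a(1), of n] assms(3) a(2) by simp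
  then have "a [^] n \<in> ?T" using ker a by simp
  then obtain m where "0 < m" "(a [^] n) [^] (m::nat) = \<one>" by (auto simp: torsion_subgroup_def)
  then have "a \<in> ?T" using a assms(2) unfolding torsion_subgroup_def
    by (auto simp: nat_pow_pow intro!: exI[of _ "n * m"])
  then show "x = \<one>\<^bsub>G Mod ?T\<^esub>" using ker a by simp
qed

text \<open>Roots are unique, so an \<open>n\<close>-th root \<open>y\<close> of an element
  \<open>x\<close> with all roots has all roots itself: if \<open>z\<close> is an
  \<open>(m * n)\<close>-th root of \<open>x\<close>, then \<open>z [^] m\<close> and
  \<open>y\<close> are both \<open>n\<close>-th roots of \<open>x\<close>. Hence the elements with
  all roots in \<open>G\<close> already form a divisible subgroup, clearly the largest.\<close>

lemma (in comm_group) max_divisible_torsion_free: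
  assumes tf: "torsion_free G"
  shows "max_divisible_subgroup G = {x \<in> carrier G. \<forall>n::nat. 0 < n \<longrightarrow> (\<exists>y\<in>carrier G. y [^] n = x)}"
    and "divisible_subgroup G (max_divisible_subgroup G)"
proof -
  define D where "D = {x \<in> carrier G. \<forall>n::nat. 0 < n \<longrightarrow> (\<exists>y\<in>carrier G. y [^] n = x)}"
  have sub: "subgroup D G"
  proof
    show "x \<otimes> y \<in> D" if "x \<in> D" "y \<in> D" for x y
      using that unfolding D_def by clarsimp (metis m_closed nat_pow_distrib)
    show "inv x \<in> D" if "x \<in> D" for x
      using that unfolding D_def by clarsimp (metis inv_closed nat_pow_inv)
    show "\<one> \<in> D" unfolding D_def by (auto intro: bexI[of _ \<one>])
  qed (auto simp: D_def)
  have div: "\<exists>y\<in>D. y [^] n = x" if x: "x \<in> D" and n: "0 < n" for x and n :: nat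
  proof -
    obtain y where y: "y \<in> carrier G" "y [^] n = x" using x n unfolding D_def by blast
    have "\<exists>z\<in>carrier G. z [^] m = y" if m: "0 < m" for m :: nat
    proof -
      have "0 < m * n" using m n by simp
      then obtain z where z: "z \<in> carrier G" "z [^] (m * n) = x" using x unfolding D_def by blast
      then have "(z [^] m) [^] n = y [^] n" using y by (simp add: nat_pow_pow)
      then have "z [^] m = y" using nat_pow_inj_torsion_free[OF tf _ y(1) n] z(1) by simp
      then show ?thesis using z by blast
    qed
    then have "y \<in> D" using y by (simp add: D_def)
    then show ?thesis using y by blast
  qed
  have D: "divisible_subgroup G D" using sub div by (simp add: divisible_subgroup_def)
  have "max_divisible_subgroup G = D"
  proof
    show "max_divisible_subgroup G \<subseteq> D"
      unfolding max_divisible_subgroup_def divisible_subgroup_def D_def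
      by (auto dest: subgroup.mem_carrier) (metis subgroup.mem_carrier)
    show "D \<subseteq> max_divisible_subgroup G" using D by (auto simp: max_divisible_subgroup_def)
  qed
  then show "max_divisible_subgroup G = {x \<in> carrier G. \<forall>n::nat. 0 < n \<longrightarrow> (\<exists>y\<in>carrier G. y [^] n = x)}"
    "divisible_subgroup G (max_divisible_subgroup G)"
    using D by (simp_all add: D_def)
qed

text \<open>Both last claims rest on divisibility of the kernel \<open>D\<close>. If
  \<open>a [^] n\<close> lies in \<open>D\<close>, it has an \<open>n\<close>-th root in
  \<open>D\<close>, which must be \<open>a\<close>. If \<open>a\<close> is an \<open>n\<close>-th
  power modulo \<open>D\<close>, the error in \<open>D\<close> is an \<open>n\<close>-th power as
  well, so \<open>a\<close> has an \<open>n\<close>-th root in \<open>G\<close>. The last claim is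
  the elementwise form of being reduced.\<close>

lemma (in comm_group) reduced_part_torsion_free:
  assumes tf: "torsion_free G"
  shows "comm_group (reduced_part G)"
    and "(\<lambda>a. max_divisible_subgroup G #> a) \<in> hom G (reduced_part G)"
    and "(\<lambda>a. max_divisible_subgroup G #> a) ` carrier G = carrier (reduced_part G)"
    and "torsion_free (reduced_part G)"
    and "\<lbrakk>x \<in> carrier (reduced_part G);
          \<And>n::nat. 0 < n \<Longrightarrow> \<exists>y\<in>carrier (reduced_part G). y [^]\<^bsub>reduced_part G\<^esub> n = x\<rbrakk>
          \<Longrightarrow> x = \<one>\<^bsub>reduced_part G\<^esub>"
proof -
  let ?D = "max_divisible_subgroup G" and ?R = "reduced_part G"
  note D_eq = max_divisible_torsion_free(1)[OF tf]
  have sub: "subgroup ?D G" and div: "\<And>x n. x \<in> ?D \<Longrightarrow> 0 < n \<Longrightarrow> \<exists>y\<in>?D. y [^] (n::nat) = x"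
    using max_divisible_torsion_free(2)[OF tf] by (auto simp: divisible_subgroup_def)
  show comm: "comm_group ?R" and hom: "(\<lambda>a. ?D #> a) \<in> hom G ?R"
    and onto: "(\<lambda>a. ?D #> a) ` carrier G = carrier ?R"
    unfolding reduced_part_def
    using comm_group_FactGroup[OF sub] rcoset_hom_FactGroup[OF sub] by auto
  have ker: "?D #> a = \<one>\<^bsub>?R\<^esub> \<longleftrightarrow> a \<in> ?D" if "a \<in> carrier G" for a
    using rcoset_hom_FactGroup(3)[OF sub that] by (simp add: reduced_part_def)
  interpret R: comm_group ?R by (fact comm)
  interpret h: group_hom G ?R "\<lambda>a. ?D #> a" using hom by unfold_locales
  have "x = \<one>\<^bsub>?R\<^esub>" if x: "x \<in> carrier ?R" and n: "0 < n" "x [^]\<^bsub>?R\<^esub> (n::nat) = \<one>\<^bsub>?R\<^esub>" for x n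
  proof -
    obtain a where a: "a \<in> carrier G" "x = ?D #> a" using x onto by blast
    have "a [^] n \<in> ?D" using h.hom_nat_pow[OF a(1), of n] n a ker[of "a [^] n"] by simp
    then obtain d where d: "d \<in> ?D" "d [^] n = a [^] n" using div n(1) by metis
    then have "d = a"
      using nat_pow_inj_torsion_free[OF tf _ a(1) n(1)] subgroup.mem_carrier[OF sub] by blast
    then show ?thesis using d a ker by blast
  qed
  then show "torsion_free ?R" by (auto simp: torsion_free_def)
  show "x = \<one>\<^bsub>?R\<^esub>" if x: "x \<in> carrier ?R"
    and all: "\<And>n::nat. 0 < n \<Longrightarrow> \<exists>y\<in>carrier ?R. y [^]\<^bsub>?R\<^esub> n = x"
  proof -
    obtain a where a: "a \<in> carrier G" "x = ?D #> a" using x onto by blast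
    have "\<exists>y\<in>carrier G. y [^] n = a" if n: "0 < n" for n :: nat
    proof -
      obtain y where "y \<in> carrier ?R" "y [^]\<^bsub>?R\<^esub> n = x" using all[OF n] by blast
      then obtain b where b: "b \<in> carrier G" "(?D #> b) [^]\<^bsub>?R\<^esub> n = x" unfolding onto[symmetric] by fast
      have "?D #> (a \<otimes> inv (b [^] n)) = \<one>\<^bsub>?R\<^esub>"
        using h.hom_mult[of a "inv (b [^] n)"] h.hom_inv[of "b [^] n"] h.hom_nat_pow[OF b(1), of n] a b x by simp
      moreover have "a \<otimes> inv (b [^] n) \<in> carrier G" using a b by simp
      ultimately have "a \<otimes> inv (b [^] n) \<in> ?D" using ker by metis
      then obtain d where d: "d \<in> ?D" "d [^] n = a \<otimes> inv (b [^] n)" using div n by blast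
      have dc: "d \<in> carrier G" by (rule subgroup.mem_carrier[OF sub d(1)])
      have "(d \<otimes> b) [^] n = a" using a b dc d(2) by (simp add: nat_pow_distrib m_assoc)
      then show ?thesis using b dc by blast
    qed
    then have "a \<in> ?D" using a D_eq by blast
    then show ?thesis using ker a by blast
  qed
qed

section \<open>Concatenation of paths\<close>

definition path_join :: "(real \<Rightarrow> 'a) \<Rightarrow> (real \<Rightarrow> 'a) \<Rightarrow> real \<Rightarrow> 'a" where
  "path_join p q = (\<lambda>t. if t \<le> 1/2 then p (2 * t) else q (2 * t - 1))"

primrec path_power :: "'a \<Rightarrow> (real \<Rightarrow> 'a) \<Rightarrow> nat \<Rightarrow> real \<Rightarrow> 'a" where
  "path_power x p 0 = (\<lambda>_. x)"
| "path_power x p (Suc n) = path_join p (path_power x p n)"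

lemma pathin_affine:
  assumes "pathin X p" "a \<in> {0..1}" "b \<in> {0..1}"
  shows "pathin X (\<lambda>t. p (a + (b - a) * t))"
proof -
  have "a + (b - a) * t \<in> {0..1}" if "t \<in> {0..1}" for t
  proof -
    have "a + (b - a) * t = (1 - t) * a + t * b" by (simp add: algebra_simps)
    also have "\<dots> \<in> {0..1}"
      using convexD[OF convex_real_interval(5)[of 0 1] assms(2,3), of "1 - t" t] that by simp
    finally show ?thesis .
  qed
  then have "continuous_map (subtopology euclideanreal {0..1}) (subtopology euclideanreal {0..1})
      (\<lambda>t. a + (b - a) * t)"
    by (auto simp: continuous_map_in_subtopology intro!: continuous_intros)
  from continuous_map_compose[OF this assms(1)[unfolded pathin_def]]
  show ?thesis by (simp add: pathin_def o_def)
qed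

lemma pathin_reverse: "pathin X p \<Longrightarrow> pathin X (\<lambda>t. p (1 - t))"
  using pathin_affine[of X p 1 0] by simp

lemma path_join_ends [simp]: "path_join p q 0 = p 0" "path_join p q 1 = q 1"
  by (simp_all add: path_join_def)

lemma pathin_join:
  assumes "pathin X p" "pathin X q" "p 1 = q 0"
  shows "pathin X (path_join p q)"
  unfolding pathin_def path_join_def
proof (rule continuous_map_cases_le)
  let ?I = "subtopology euclideanreal {0..1}"
  have sub: "subtopology ?I {x \<in> topspace ?I. x \<le> 1/2} = subtopology euclideanreal {0..1/2}"
    "subtopology ?I {x \<in> topspace ?I. 1/2 \<le> x} = subtopology euclideanreal {1/2..1}"
    by (auto simp: subtopology_subtopology intro!: arg_cong[where f = "subtopology euclideanreal"])
  have "continuous_map (subtopology euclideanreal {0..1/2}) ?I (\<lambda>t. 2 * t)"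
    by (auto simp: continuous_map_in_subtopology intro!: continuous_intros)
  then show "continuous_map (subtopology ?I {x \<in> topspace ?I. x \<le> 1/2}) X (\<lambda>t. p (2 * t))"
    unfolding sub using continuous_map_compose[of _ ?I "\<lambda>t. 2 * t" X p] assms(1) by (simp add: pathin_def o_def)
  have "continuous_map (subtopology euclideanreal {1/2..1}) ?I (\<lambda>t. 2 * t - 1)"
    by (auto simp: continuous_map_in_subtopology intro!: continuous_intros)
  then show "continuous_map (subtopology ?I {x \<in> topspace ?I. 1/2 \<le> x}) X (\<lambda>t. q (2 * t - 1))"
    unfolding sub using continuous_map_compose[of _ ?I "\<lambda>t. 2 * t - 1" X q] assms(2) by (simp add: pathin_def o_def)
  show "p (2 * t) = q (2 * t - 1)" if "t = 1/2" for t :: real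
    unfolding that using assms(3) by simp
qed (auto intro!: continuous_intros)

lemma path_power_ends:
  assumes "p 0 = x" "p 1 = x"
  shows "path_power x p n 0 = x" "path_power x p n 1 = x"
  using assms by (induction n) auto

lemma pathin_power:
  assumes "pathin X p" "p 0 = x" "p 1 = x"
  shows "pathin X (path_power x p n)"
proof (induction n)
  case 0
  then show ?case using assms path_start_in_topspace by fastforce
next
  case (Suc n)
  then show ?case using assms path_power_ends[of p x n] by (auto intro: pathin_join)
qed

section \<open>Uniform estimates and infinite concatenations in a metric space\<close>

lemma (in Metric_space) dist_path_join_le:
  assumes "\<And>t. t \<in> {0..1} \<Longrightarrow> d (p t) (p' t) \<le> e" "\<And>t. t \<in> {0..1} \<Longrightarrow> d (q t) (q' t) \<le> e" "t \<in> {0..1}"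
  shows "d (path_join p q t) (path_join p' q' t) \<le> e"
  using assms(1)[of "2 * t"] assms(2)[of "2 * t - 1"] assms(3) by (auto simp: path_join_def)

lemma (in Metric_space) dist_path_power_le:
  assumes "\<And>t. t \<in> {0..1} \<Longrightarrow> d (p t) (p' t) \<le> e" "0 \<le> e" "x \<in> M" "t \<in> {0..1}"
  shows "d (path_power x p n t) (path_power x p' n t) \<le> e"
  using assms(4)
proof (induction n arbitrary: t)
  case (Suc n)
  then show ?case unfolding path_power.simps by (intro dist_path_join_le assms(1))
qed (use assms in simp)

text \<open>Since concatenation is nonexpansive for the uniform distance, the finite truncations of the nested
  infinite concatenation are uniformly Cauchy.\<close>
lemma (in Metric_space) nested_infinite_concatenation:
  assumes "mcomplete" "x \<in> M"
    and l: "\<And>n. pathin mtopology (l n)" "\<And>n. l n 0 = x" "\<And>n. l n 1 = x"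
    and small: "\<And>n t. t \<in> {0..1} \<Longrightarrow> d x (l n t) \<le> (1/2) ^ n"
  obtains y where "\<And>n. pathin mtopology (y n)" "\<And>n. y n 0 = x" "\<And>n. y n 1 = x"
    "\<And>n t. t \<in> {0..1} \<Longrightarrow> y n t = path_join (l n) (path_power x (y (Suc n)) (k n)) t"
proof -
  define F where "F n y = path_join (l n) (path_power x y (k n))" for n y
  \<comment> \<open>\<open>a m n\<close> is the \<open>m\<close>-th truncation of the future
    \<open>y n\<close>: the recursion \<open>y n = F n (y (Suc n))\<close> is unfolded
    \<open>m\<close> times and stopped with the constant path. The recursion on \<open>m\<close>
    treats all \<open>n\<close> at once because the index shifts.\<close>
  define a where "a = rec_nat (\<lambda>n t. x) (\<lambda>m f n. F n (f (Suc n)))"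
  have a_0: "a 0 n = (\<lambda>t. x)" and a_Suc: "a (Suc m) n = F n (a m (Suc n))" for m n
    by (simp_all add: a_def)
  have a_loop: "pathin mtopology (a m n) \<and> a m n 0 = x \<and> a m n 1 = x" for m n
  proof (induction m arbitrary: n)
    case (Suc m)
    then show ?case
      using l path_power_ends[of "a m (Suc n)" x "k n"] pathin_power[of mtopology "a m (Suc n)" x]
      by (auto simp: a_Suc F_def intro!: pathin_join)
  qed (use assms(2) in \<open>simp add: a_0\<close>)
  have in_M: "p t \<in> M" if "pathin mtopology p" "t \<in> {0..1}" for p t
    using path_image_subset_topspace[OF that(1)] that(2) by auto
  have nonexp: "d (F n p t) (F n q t) \<le> e"
    if "\<And>t. t \<in> {0..1} \<Longrightarrow> d (p t) (q t) \<le> e" "0 \<le> e" "t \<in> {0..1}" for n p q e t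
    unfolding F_def
    by (intro dist_path_join_le dist_path_power_le that) (use assms(2) that in_M[OF l(1)] in auto)
  \<comment> \<open>Consecutive truncations differ only in the innermost loop
    \<open>l (n + m)\<close>, which one of them replaces by the constant path; the surrounding
    concatenations do not enlarge the distance.\<close>
  have step: "d (a m n t) (a (Suc m) n t) \<le> (1/2) ^ (n + m)" if "t \<in> {0..1}" for m n t
    using that
  proof (induction m arbitrary: n t)
    case 0
    have const: "path_power x (\<lambda>t. x) j s = x" for j s
      by (induction j arbitrary: s) (auto simp: path_join_def)
    show ?case
    proof (cases "t \<le> 1/2")
      case True
      then show ?thesis using small[of "2 * t" n] 0 by (simp add: a_0 a_Suc F_def path_join_def)
    next
      case False
      then show ?thesis using assms(2) by (simp add: a_0 a_Suc F_def path_join_def const)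
    qed
  next
    case (Suc m)
    have "d (F n (a m (Suc n)) t) (F n (a (Suc m) (Suc n)) t) \<le> (1/2) ^ (Suc n + m)"
    proof (rule nonexp)
      show "d (a m (Suc n) s) (a (Suc m) (Suc n) s) \<le> (1/2) ^ (Suc n + m)" if "s \<in> {0..1}" for s
        by (rule Suc.IH[OF that])
    qed (use Suc.prems in auto)
    then show ?case by (simp only: a_Suc add_Suc add_Suc_right)
  qed
  \<comment> \<open>Partial sum of the geometric series from the previous estimate, with the factor
    \<open>(1/2) ^ n\<close> bounded by 1.\<close>
  have tail: "d (a m n t) (a (m + j) n t) \<le> 2 * (1/2) ^ m - 2 * (1/2) ^ (m + j)" if t: "t \<in> {0..1}" for m n j t
  proof (induction j)
    case 0
    then show ?case using in_M[of "a m n" t] a_loop t by simp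
  next
    case (Suc j)
    have "d (a m n t) (a (m + Suc j) n t) \<le> d (a m n t) (a (m + j) n t) + d (a (m + j) n t) (a (Suc (m + j)) n t)"
      using triangle[of "a m n t" "a (m + j) n t" "a (Suc (m + j)) n t"] in_M a_loop t by simp
    also have "d (a (m + j) n t) (a (Suc (m + j)) n t) \<le> (1/2) ^ (n + (m + j))" by (rule step[OF t])
    also have "(1/2) ^ (n + (m + j)) \<le> (1/2 :: real) ^ (m + j)" by (rule power_decreasing) auto
    finally show ?case using Suc by simp
  qed
  have Cauchy: "\<exists>N. \<forall>m m' t. N \<le> m \<longrightarrow> N \<le> m' \<longrightarrow> t \<in> topspace (subtopology euclideanreal {0..1})
      \<longrightarrow> d (a m n t) (a m' n t) < e" if e: "0 < e" for n e
  proof -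
    obtain N where "(1/2) ^ N < e / 2"
      using real_arch_pow_inv[of "e / 2" "1/2"] e by auto
    then have N: "2 * (1/2) ^ N < e" by linarith
    have "d (a m n t) (a m' n t) < e" if "N \<le> m" "m \<le> m'" "t \<in> {0..1}" for m m' t
    proof -
      have "d (a m n t) (a m' n t) \<le> 2 * (1/2) ^ m - 2 * (1/2) ^ m'"
        using tail[OF that(3), of m n "m' - m"] that(2) by simp
      also have "\<dots> \<le> 2 * (1/2) ^ m" by simp
      also have "\<dots> \<le> 2 * (1/2) ^ N" using that(1) by (simp add: power_decreasing)
      finally show ?thesis using N by simp
    qed
    then show ?thesis by (metis commute nle_le topspace_euclidean_subtopology)
  qed
  have "\<forall>n. \<exists>g. pathin mtopology g \<and> (\<forall>e>0. \<forall>\<^sub>F m in sequentially. \<forall>t\<in>{0..1}. d (a m n t) (g t) < e)"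
  proof
    fix n
    obtain g where "continuous_map (subtopology euclideanreal {0..1}) mtopology g"
      "\<And>e. 0 < e \<Longrightarrow> \<forall>\<^sub>F m in sequentially. \<forall>t\<in>topspace (subtopology euclideanreal {0..1}). d (a m n t) (g t) < e"
      using continuous_map_uniformly_Cauchy_limit[OF assms(1) _ Cauchy, of n] a_loop[of _ n, unfolded pathin_def] by auto
    then show "\<exists>g. pathin mtopology g \<and> (\<forall>e>0. \<forall>\<^sub>F m in sequentially. \<forall>t\<in>{0..1}. d (a m n t) (g t) < e)"
      by (auto simp: pathin_def)
  qed
  from choice[OF this] obtain y where Y: "\<forall>n. pathin mtopology (y n)
      \<and> (\<forall>e>0. \<forall>\<^sub>F m in sequentially. \<forall>t\<in>{0..1}. d (a m n t) (y n t) < e)" ..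
  then have y: "\<And>n. pathin mtopology (y n)" by blast
  have lim: "\<forall>\<^sub>F m in sequentially. \<forall>t\<in>{0..1}. d (a m n t) (y n t) < e" if "0 < e" for n e
    using Y that by blast
  have eq: "u = v" if "u \<in> M" "v \<in> M" "\<And>e. 0 < e \<Longrightarrow> d u v \<le> e" for u v
  proof -
    have "d u v \<le> 0" by (rule field_le_epsilon) (use that(3) in simp)
    then show ?thesis using that nonneg[of u v] by simp
  qed
  show thesis
  proof
    show "pathin mtopology (y n)" for n by (rule y)
    have ends: "y n s = x" if s: "s \<in> {0..1}" "\<And>m. a m n s = x" for n s
    proof (rule eq)
      fix e :: real assume "0 < e"
      from eventually_happens'[OF _ lim[OF this, of n]] s show "d (y n s) x \<le> e"
        by (fastforce simp: commute)
    qed (use in_M[OF y] s assms(2) in auto)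
    show "y n 0 = x" "y n 1 = x" for n by (rule ends; use a_loop in simp)+
    then have loop: "pathin mtopology (F n (y (Suc n)))" for n
      unfolding F_def using l y path_power_ends[of "y (Suc n)" x] pathin_power[of mtopology "y (Suc n)" x]
      by (intro pathin_join) auto
    \<comment> \<open>For large \<open>m\<close> both sides are within \<open>e/2\<close> of
      \<open>a (Suc m) n = F n (a m (Suc n))\<close>: the left side by convergence, the right side
      because \<open>F n\<close> is nonexpansive.\<close>
    have "y n t = F n (y (Suc n)) t" if t: "t \<in> {0..1}" for n t
    proof (rule eq)
      fix e :: real assume e: "0 < e"
      have "\<forall>\<^sub>F m in sequentially. \<forall>t\<in>{0..1}. d (a (Suc m) n t) (y n t) < e/2"
        by (rule iffD2[OF eventually_sequentially_Suc[of "\<lambda>m. \<forall>t\<in>{0..1}. d (a m n t) (y n t) < e/2"]])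
          (use lim[of "e/2" n] e in simp)
      moreover have "\<forall>\<^sub>F m in sequentially. \<forall>t\<in>{0..1}. d (a m (Suc n) t) (y (Suc n) t) < e/2"
        using lim[of "e/2" "Suc n"] e by simp
      ultimately have "\<forall>\<^sub>F m in sequentially. (\<forall>t\<in>{0..1}. d (a (Suc m) n t) (y n t) < e/2)
          \<and> (\<forall>t\<in>{0..1}. d (a m (Suc n) t) (y (Suc n) t) < e/2)"
        by (rule eventually_conj)
      then obtain m where m: "\<forall>t\<in>{0..1}. d (a (Suc m) n t) (y n t) < e/2"
        "\<forall>t\<in>{0..1}. d (a m (Suc n) t) (y (Suc n) t) < e/2"
        using eventually_happens'[OF sequentially_bot] by blast
      have "d (F n (a m (Suc n)) t) (F n (y (Suc n)) t) \<le> e/2"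
        by (rule nonexp[OF less_imp_le]) (use bspec[OF m(2)] e t in auto)
      moreover have "d (y n t) (F n (a m (Suc n)) t) \<le> e/2"
        using bspec[OF m(1) t] commute[of "y n t"] by (simp add: a_Suc)
      moreover have "F n (a m (Suc n)) t \<in> M" using in_M[of "a (Suc m) n" t] a_loop[of "Suc m" n] t by (simp add: a_Suc)
      ultimately show "d (y n t) (F n (y (Suc n)) t) \<le> e"
        using triangle[of "y n t" "F n (a m (Suc n)) t" "F n (y (Suc n)) t"] in_M[OF y t] in_M[OF loop t] by simp
    qed (use in_M[OF y t] in_M[OF loop t] in auto)
    then show "y n t = path_join (l n) (path_power x (y (Suc n)) (k n)) t" if "t \<in> {0..1}" for n t
      using that by (simp add: F_def)
  qed
qed

section \<open>Singular 1-simplices and paths\<close>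

text \<open>The barycentric coordinate \<open>x 1\<close> plays the role of time, so vertex 0 is the
  start of the path. The restriction makes the function extensional, as singular simplices
  are.\<close>

definition path_simplex :: "(real \<Rightarrow> 'a) \<Rightarrow> (nat \<Rightarrow> real) \<Rightarrow> 'a" where
  "path_simplex p = restrict (\<lambda>x. p (x 1)) (standard_simplex 1)"

definition vertex :: "'a \<Rightarrow> (nat \<Rightarrow> real) \<Rightarrow> 'a" where
  "vertex v = restrict (\<lambda>_. v) (standard_simplex 0)"

lemma path_simplex_cong:
  assumes "\<And>t. t \<in> {0..1} \<Longrightarrow> p t = q t" shows "path_simplex p = path_simplex q"
  unfolding path_simplex_def
  by (rule restrict_ext) (auto simp: standard_simplex_def intro: assms)

lemma singular_simplex_path_simplex:
  assumes "pathin X p" shows "singular_simplex 1 X (path_simplex p)"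
proof -
  have "continuous_map (subtopology (powertop_real UNIV) (standard_simplex 1))
      (subtopology euclideanreal {0..1}) (\<lambda>x. x 1)"
    by (auto simp: continuous_map_in_subtopology standard_simplex_def
        intro!: continuous_map_from_subtopology continuous_map_product_projection)
  from continuous_map_compose[OF this assms[unfolded pathin_def]]
  show ?thesis
    unfolding singular_simplex_def path_simplex_def by (auto simp: o_def intro: continuous_map_eq)
qed

lemma singular_simplex_1E:
  assumes "singular_simplex 1 X s"
  obtains p where "pathin X p" "s = path_simplex p"
proof
  \<comment> \<open>\<open>e\<close> inverts the coordinate \<open>x 1\<close> on the standard
    1-simplex, so composing with it recovers a path from a simplex.\<close>
  define e :: "real \<Rightarrow> nat \<Rightarrow> real" where "e t = (\<lambda>i. if i = 0 then 1 - t else if i = 1 then t else 0)" for t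
  have s: "continuous_map (subtopology (powertop_real UNIV) (standard_simplex 1)) X s"
    "s \<in> extensional (standard_simplex 1)"
    using assms by (auto simp: singular_simplex_def)
  have "continuous_map (subtopology euclideanreal {0..1})
      (subtopology (powertop_real UNIV) (standard_simplex 1)) e"
  proof (unfold continuous_map_in_subtopology continuous_map_componentwise_UNIV, intro conjI allI)
    show "continuous_map (subtopology euclideanreal {0..1}) euclideanreal (\<lambda>t. e t i)" for i
      unfolding e_def by (cases "i = 0"; cases "i = 1") (auto intro!: continuous_intros)
    show "e \<in> topspace (subtopology euclideanreal {0..1}) \<rightarrow> standard_simplex 1"
      by (auto simp: e_def standard_simplex_def)
  qed
  from continuous_map_compose[OF this s(1)] show "pathin X (\<lambda>t. s (e t))" by (simp add: pathin_def o_def)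
  show "s = path_simplex (\<lambda>t. s (e t))"
  proof
    fix x
    have "e (x 1) = x" if "x \<in> standard_simplex 1"
    proof
      fix i
      have "x 0 + x 1 = 1" "\<And>j. 1 < j \<Longrightarrow> x j = 0" using that by (auto simp: standard_simplex_def)
      then show "e (x 1) i = x i" unfolding e_def by (cases "i = 0"; cases "i = 1") auto
    qed
    then show "s x = path_simplex (\<lambda>t. s (e t)) x"
      using s(2) by (simp add: path_simplex_def extensional_def)
  qed
qed

lemma vertex_apply [simp]: "vertex v (\<lambda>j. if j = 0 then 1 else 0) = v"
  by (simp add: vertex_def)

text \<open>Face \<open>k\<close> omits vertex \<open>k\<close>; hence face 0 is the end point and
  face 1 the starting point.\<close>

lemma singular_face_path_simplex [simp]:
  "singular_face 1 0 (path_simplex p) = vertex (p 1)" "singular_face 1 1 (path_simplex p) = vertex (p 0)"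
  unfolding singular_face_def path_simplex_def vertex_def
  using simplical_face_in_standard_simplex[of 1 0] simplical_face_in_standard_simplex[of 1 1]
  by (auto simp: standard_simplex_0 simplical_face_def fun_eq_iff restrict_def)

lemma chain_boundary_path_simplex:
  "chain_boundary 1 (frag_of (path_simplex p)) = frag_of (vertex (p 1)) - frag_of (vertex (p 0))"
  using singular_face_path_simplex[of p] by (simp add: chain_boundary_of)

text \<open>The singular 2-simplex \<^term>\<open>\<lambda>x. p (a * x 0 + b * x 1 + c * x 2)\<close> has the three subpaths of
  \<^term>\<open>p\<close> between the parameters \<^term>\<open>a\<close>, \<^term>\<open>b\<close> and \<^term>\<open>c\<close> as its faces.\<close>
lemma boundary_affine_triangle:
  assumes "pathin X p" and abc: "a \<in> {0..1}" "b \<in> {0..1}" "c \<in> {0..1}"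
  shows "singular_relboundary 1 X {}
    (frag_of (path_simplex (\<lambda>t. p (b + (c - b) * t))) - frag_of (path_simplex (\<lambda>t. p (a + (c - a) * t)))
      + frag_of (path_simplex (\<lambda>t. p (a + (b - a) * t))))"
proof -
  define s where "s = restrict (\<lambda>x. p (a * x 0 + b * x 1 + c * x (2::nat))) (standard_simplex 2)"
  have atMost2: "{..2::nat} = {0, 1, 2}" by auto
  have "a * x 0 + b * x 1 + c * x 2 \<in> {0..1}" if "x \<in> standard_simplex 2" for x :: "nat \<Rightarrow> real"
  proof -
    have x: "x 0 + x 1 + x 2 = 1" "0 \<le> x 0" "0 \<le> x 1" "0 \<le> x 2"
      using that by (auto simp: standard_simplex_def atMost2)
    have "a * x 0 + b * x 1 + c * x 2 \<le> 1 * x 0 + 1 * x 1 + 1 * x 2"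
      by (intro add_mono mult_right_mono) (use x abc in auto)
    then show ?thesis using x abc by simp
  qed
  then have "continuous_map (subtopology (powertop_real UNIV) (standard_simplex 2))
      (subtopology euclideanreal {0..1}) (\<lambda>x. a * x 0 + b * x 1 + c * x 2)"
    by (auto simp: continuous_map_in_subtopology
        intro!: continuous_map_from_subtopology continuous_intros continuous_map_product_projection)
  from continuous_map_compose[OF this assms(1)[unfolded pathin_def]]
  have "singular_simplex 2 X s"
    unfolding singular_simplex_def s_def by (auto simp: o_def intro: continuous_map_eq)
  then have "singular_chain (Suc 1) X (frag_of s)" by (simp add: singular_chain_of numeral_2_eq_2)
  moreover have "chain_boundary (Suc 1) (frag_of s) =
    frag_of (path_simplex (\<lambda>t. p (b + (c - b) * t))) - frag_of (path_simplex (\<lambda>t. p (a + (c - a) * t)))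
      + frag_of (path_simplex (\<lambda>t. p (a + (b - a) * t)))"
  proof -
    have face: "singular_face 2 k s = path_simplex (\<lambda>t. p (r t))"
      if "k \<le> 2" and r: "\<And>x::nat \<Rightarrow> real. x 0 = 1 - x 1 \<Longrightarrow>
        a * simplical_face k x 0 + b * simplical_face k x 1 + c * simplical_face k x 2 = r (x 1)" for k r
    proof
      fix x :: "nat \<Rightarrow> real"
      have "x 0 = 1 - x 1" if "x \<in> standard_simplex 1" using that by (auto simp: standard_simplex_def)
      moreover have "simplical_face k x \<in> standard_simplex 2" if "x \<in> standard_simplex 1"
        using simplical_face_in_standard_simplex[of 2 k x] that \<open>k \<le> 2\<close> by simp
      ultimately show "singular_face 2 k s x = path_simplex (\<lambda>t. p (r t)) x"
        using r[of x] by (simp add: singular_face_def path_simplex_def s_def)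
    qed
    have "singular_face 2 0 s = path_simplex (\<lambda>t. p (b + (c - b) * t))"
      by (rule face) (simp_all add: simplical_face_def left_diff_distrib right_diff_distrib)
    moreover have "singular_face 2 1 s = path_simplex (\<lambda>t. p (a + (c - a) * t))"
      by (rule face) (simp_all add: simplical_face_def left_diff_distrib right_diff_distrib)
    moreover have "singular_face 2 2 s = path_simplex (\<lambda>t. p (a + (b - a) * t))"
      by (rule face) (simp_all add: simplical_face_def left_diff_distrib right_diff_distrib)
    ultimately show ?thesis by (simp add: chain_boundary_of atMost2 flip: numeral_2_eq_2)
  qed
  ultimately show ?thesis unfolding singular_boundary by blast
qed

section \<open>Constant, concatenated and reversed paths up to boundaries\<close>

text \<open>All three faces of a constant triangle are the constant path, and their alternating sum
  leaves one copy.\<close>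

lemma boundary_const_path:
  assumes "x \<in> topspace X" shows "singular_relboundary 1 X {} (frag_of (path_simplex (\<lambda>_. x)))"
  using boundary_affine_triangle[of X "\<lambda>_. x" 0 0 0] assms by simp

text \<open>The affine triangle of the joined path at the parameters 0, 1/2 and 1 has
  \<open>p\<close>, \<open>q\<close> and the whole path as its faces.\<close>

lemma boundary_path_join:
  assumes "pathin X p" "pathin X q" "p 1 = q 0"
  shows "singular_relboundary 1 X {}
    (frag_of (path_simplex p) + frag_of (path_simplex q) - frag_of (path_simplex (path_join p q)))"
proof -
  have "path_simplex (\<lambda>t. path_join p q (1/2 + (1 - 1/2) * t)) = path_simplex q"
    by (rule path_simplex_cong) (use assms(3) in \<open>auto simp: path_join_def algebra_simps\<close>)
  moreover have "path_simplex (\<lambda>t. path_join p q (0 + (1/2 - 0) * t)) = path_simplex p"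
    by (rule path_simplex_cong) (auto simp: path_join_def)
  ultimately show ?thesis
    using boundary_affine_triangle[OF pathin_join[OF assms], of 0 "1/2" 1] by (simp add: algebra_simps)
qed

text \<open>The parameters 0, 1 and 0 give the faces \<open>p\<close>, its reverse and a constant
  path; the latter is itself a boundary.\<close>

lemma boundary_path_reverse:
  assumes "pathin X p"
  shows "singular_relboundary 1 X {} (frag_of (path_simplex p) + frag_of (path_simplex (\<lambda>t. p (1 - t))))"
proof -
  have "singular_relboundary 1 X {} (frag_of (path_simplex (\<lambda>t. p (1 - t))) - frag_of (path_simplex (\<lambda>t. p 0))
      + frag_of (path_simplex p))"
    using boundary_affine_triangle[OF assms, of 0 1 0] by simp
  from singular_relboundary_add[OF this boundary_const_path[of "p 0" X]] show ?thesis
    using path_start_in_topspace[OF assms] by (simp add: add.commute)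
qed

text \<open>Adding a chain \<open>g v\<close> for each boundary vertex \<open>v\<close> of a cycle changes nothing in total, but turns
  every single simplex into a cycle if all \<open>g v\<close> run from one base point to \<open>v\<close>.\<close>
lemma cycle_eq_sum_of_based_cycles:
  fixes c :: "'a chain"
  assumes "singular_relcycle 1 X {} c"
  shows "c = frag_extend (\<lambda>s. frag_of s + g (singular_face 1 1 s) - g (singular_face 1 0 s)) c"
proof -
  \<comment> \<open>By linearity the corrections add up to minus the value of \<open>g\<close> on
    the boundary of \<open>c\<close>, which vanishes for a cycle. The identity is checked on single
    simplices.\<close>
  have "frag_extend (\<lambda>s. frag_of s + g (singular_face 1 1 s) - g (singular_face 1 0 s)) c
      = c - frag_extend g (chain_boundary 1 c)"
  proof (rule frag_induction[of c UNIV])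
    fix s :: "(nat \<Rightarrow> real) \<Rightarrow> 'a"
    have "chain_boundary 1 (frag_of s) = frag_of (singular_face 1 0 s) - frag_of (singular_face 1 1 s)"
      by (simp add: chain_boundary_of)
    then show "frag_extend (\<lambda>s. frag_of s + g (singular_face 1 1 s) - g (singular_face 1 0 s)) (frag_of s)
        = frag_of s - frag_extend g (chain_boundary 1 (frag_of s))"
      by (simp add: frag_extend_diff)
  qed (simp_all add: frag_extend_diff chain_boundary_diff)
  then show ?thesis using assms by (simp add: singular_cycle)
qed

section \<open>Homomorphisms from the group of 1-cycles\<close>

lemma finite_image_factor:
  assumes "finite (k ` T)" "\<And>s s'. \<lbrakk>s \<in> T; s' \<in> T; k s = k s'\<rbrakk> \<Longrightarrow> f s = f s'"
  shows "finite (f ` T)"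
proof -
  have "f s = f (inv_into T k (k s))" if "s \<in> T" for s
    using that by (intro assms(2)) (auto simp: inv_into_into f_inv_into_f)
  then have "f ` T \<subseteq> (\<lambda>u. f (inv_into T k u)) ` (k ` T)" by force
  then show ?thesis using assms(1) finite_subset by blast
qed

text \<open>Chain-level presentation of a quotient of the first homology group: an epimorphism from
  the 1-cycles that kills boundaries. It allows working with chains instead of iterated
  cosets.\<close>

locale cycle_hom = comm_group R for R (structure) +
  fixes X :: "'x topology" and \<Phi>
  assumes hom: "\<Phi> \<in> hom (relcycle_group 1 X {}) R"
    and onto: "\<Phi> ` singular_relcycle_set 1 X {} = carrier R"
    and boundary: "singular_relboundary 1 X {} c \<Longrightarrow> \<Phi> c = \<one>"
begin

abbreviation cycle :: "'x chain \<Rightarrow> bool" where "cycle \<equiv> singular_relcycle 1 X {}"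

definition loop :: "'x \<Rightarrow> (real \<Rightarrow> 'x) \<Rightarrow> bool" where
  "loop x p \<longleftrightarrow> pathin X p \<and> p 0 = x \<and> p 1 = x"

abbreviation path_chain :: "(real \<Rightarrow> 'x) \<Rightarrow> 'x chain" where "path_chain p \<equiv> frag_of (path_simplex p)"

sublocale \<Phi>: group_hom "relcycle_group 1 X {}" R \<Phi>
  using hom by (simp add: group_hom_def group_hom_axioms_def is_group)

lemma \<Phi>_closed: "cycle c \<Longrightarrow> \<Phi> c \<in> carrier R"
  using \<Phi>.hom_closed[of c] by simp

lemma \<Phi>_add: "\<lbrakk>cycle a; cycle b\<rbrakk> \<Longrightarrow> \<Phi> (a + b) = \<Phi> a \<otimes> \<Phi> b"
  using \<Phi>.hom_mult[of a b] by simp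

lemma \<Phi>_zero: "\<Phi> 0 = \<one>"
  by (rule boundary) simp

lemma \<Phi>_diff:
  assumes "cycle a" "cycle b" shows "\<Phi> (a - b) = \<Phi> a \<otimes> inv (\<Phi> b)"
proof -
  have "\<Phi> (a - b) \<otimes> \<Phi> b = \<Phi> a"
    using \<Phi>_add[of "a - b" b] assms by (simp add: singular_relcycle_diff)
  then show ?thesis using assms by (auto simp: \<Phi>_closed singular_relcycle_diff inv_solve_right)
qed

lemma \<Phi>_eqI:
  assumes "cycle a" "cycle b" "\<Phi> (a - b) = \<one>" shows "\<Phi> a = \<Phi> b"
  using assms \<Phi>_add[of "a - b" b] by (simp add: singular_relcycle_diff \<Phi>_closed)

lemma \<Phi>_frag_extend_mem:
  assumes "subgroup S R" and g: "\<And>s. s \<in> Poly_Mapping.keys c \<Longrightarrow> cycle (g s) \<and> \<Phi> (g s) \<in> S"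
  shows "\<Phi> (frag_extend g c) \<in> S"
proof -
  \<comment> \<open>Being a cycle is carried through the induction, since \<Phi> is known to respect
    differences only of cycles.\<close>
  have "cycle (frag_extend g c) \<and> \<Phi> (frag_extend g c) \<in> S"
  proof (rule frag_induction[of c "Poly_Mapping.keys c"])
    fix a b
    assume "cycle (frag_extend g a) \<and> \<Phi> (frag_extend g a) \<in> S"
      "cycle (frag_extend g b) \<and> \<Phi> (frag_extend g b) \<in> S"
    then show "cycle (frag_extend g (a - b)) \<and> \<Phi> (frag_extend g (a - b)) \<in> S"
      using assms(1) by (simp add: frag_extend_diff singular_relcycle_diff \<Phi>_diff
        subgroup.m_closed subgroup.m_inv_closed)
  qed (use g assms(1) in \<open>auto simp: \<Phi>_zero subgroup.one_closed\<close>)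
  then show ?thesis by simp
qed

lemma singular_chain_path: "pathin X p \<Longrightarrow> singular_chain 1 X (path_chain p)"
  using singular_simplex_path_simplex[of X p] by (simp add: singular_chain_of)

lemma cycle_loop: "loop x p \<Longrightarrow> cycle (path_chain p)"
  using singular_chain_path chain_boundary_path_simplex[of p] by (simp add: singular_cycle loop_def)

lemma \<Phi>_loop_join:
  assumes "loop x p" "loop x q"
  shows "\<Phi> (path_chain (path_join p q)) = \<Phi> (path_chain p) \<otimes> \<Phi> (path_chain q)"
proof -
  have j: "loop x (path_join p q)" using assms by (auto simp: loop_def intro: pathin_join)
  have "singular_relboundary 1 X {} (path_chain p + path_chain q - path_chain (path_join p q))"
    using assms by (intro boundary_path_join) (auto simp: loop_def)
  from \<Phi>_eqI[OF _ _ boundary[OF this]]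
  have "\<Phi> (path_chain p + path_chain q) = \<Phi> (path_chain (path_join p q))"
    using assms j cycle_loop by (blast intro: singular_relcycle_add)
  then show ?thesis using assms cycle_loop by (metis \<Phi>_add)
qed

lemma loop_const: "x \<in> topspace X \<Longrightarrow> loop x (\<lambda>_. x)"
  by (simp add: loop_def)

lemma \<Phi>_loop_const: "x \<in> topspace X \<Longrightarrow> \<Phi> (path_chain (\<lambda>_. x)) = \<one>"
  by (intro boundary boundary_const_path)

lemma loop_topspace: "loop x p \<Longrightarrow> x \<in> topspace X"
  using path_start_in_topspace by (auto simp: loop_def)

lemma loop_power: "loop x p \<Longrightarrow> loop x (path_power x p n)"
  by (simp add: loop_def path_power_ends pathin_power)

lemma \<Phi>_loop_power:
  assumes "loop x p" shows "\<Phi> (path_chain (path_power x p n)) = \<Phi> (path_chain p) [^] n"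
proof (induction n)
  case 0
  then show ?case using \<Phi>_loop_const loop_topspace[OF assms] by simp
next
  case (Suc n)
  have "\<Phi> (path_chain p) \<in> carrier R" using \<Phi>_closed cycle_loop assms by blast
  then show ?case
    using \<Phi>_loop_join[OF assms loop_power[OF assms, of n]] Suc by (simp add: m_comm)
qed

text \<open>Up to boundaries, subtracting \<open>h\<close> means adding its reverse, and sums of
  consecutive paths may be concatenated. So the cycle is homologous to the loop that goes out along
  \<open>g\<close>, follows \<open>s\<close> and returns along \<open>h\<close>.\<close>

lemma based_cycle:
  assumes "pathin X g" "pathin X s" "pathin X h" "g 0 = x" "h 0 = x" "g 1 = s 0" "h 1 = s 1"
  defines "p \<equiv> path_join g (path_join s (\<lambda>t. h (1 - t)))"
  shows "loop x p" "cycle (path_chain s + path_chain g - path_chain h)"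
    "\<Phi> (path_chain s + path_chain g - path_chain h) = \<Phi> (path_chain p)"
proof -
  let ?r = "\<lambda>t. h (1 - t)"
  have r: "pathin X ?r" using assms(3) by (rule pathin_reverse)
  have sr: "pathin X (path_join s ?r)" using assms r by (auto intro: pathin_join)
  show p: "loop x p" unfolding loop_def p_def using assms sr by (auto intro: pathin_join)
  have "chain_boundary 1 (path_chain s + path_chain g - path_chain h) = 0"
    unfolding chain_boundary_add chain_boundary_diff chain_boundary_path_simplex using assms by simp
  then show c: "cycle (path_chain s + path_chain g - path_chain h)"
    unfolding singular_cycle
    by (intro conjI singular_chain_diff singular_chain_add singular_chain_path) (use assms in auto)
  have 1: "singular_relboundary 1 X {} (path_chain s + path_chain ?r - path_chain (path_join s ?r))"
    by (rule boundary_path_join) (use assms r in auto)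
  have 2: "singular_relboundary 1 X {} (path_chain g + path_chain (path_join s ?r) - path_chain p)"
    unfolding p_def by (rule boundary_path_join) (use assms sr in auto)
  have 3: "singular_relboundary 1 X {} (path_chain h + path_chain ?r)"
    by (rule boundary_path_reverse) fact
  have "singular_relboundary 1 X {} (path_chain s + path_chain g - path_chain h - path_chain p)"
    using singular_relboundary_diff[OF singular_relboundary_add[OF 1 2] 3] by (simp add: algebra_simps)
  then show "\<Phi> (path_chain s + path_chain g - path_chain h) = \<Phi> (path_chain p)"
    using \<Phi>_eqI[OF c cycle_loop[OF p]] boundary by blast
qed

section \<open>A point with nontrivial cycles in every neighbourhood: continuum many classes\<close>

text \<open>Connecting the vertices of \<open>c\<close> to \<open>x\<close> inside \<open>V\<close>
  writes \<open>c\<close> as a combination of cycles, each with the class of a loop in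
  \<open>V\<close>. If all these classes were trivial, that of \<open>c\<close> would be
  too.\<close>

lemma nontrivial_loop:
  assumes V: "path_connectedin X V" "x \<in> V"
    and c: "singular_relcycle 1 (subtopology X V) {} c" "\<Phi> c \<noteq> \<one>"
  obtains p where "loop x p" "\<And>t. t \<in> {0..1} \<Longrightarrow> p t \<in> V" "\<Phi> (path_chain p) \<noteq> \<one>"
proof -
  let ?Y = "subtopology X V"
  have VX: "V \<subseteq> topspace X" using V by (simp add: path_connectedin_def)
  have "\<forall>v\<in>V. \<exists>g. pathin ?Y g \<and> g 0 = x \<and> g 1 = v"
    using V VX unfolding path_connectedin_def path_connected_space_def by (auto simp: inf_absorb2)
  then obtain g where g: "\<And>v. v \<in> V \<Longrightarrow> pathin ?Y (g v) \<and> g v 0 = x \<and> g v 1 = v" by metis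
  \<comment> \<open>The argument of \<open>w\<close> is the only point of the standard 0-simplex, so
    \<open>G\<close> attaches the connecting path to the vertex that the 0-simplex \<open>w\<close>
    represents.\<close>
  define G where "G w = path_chain (g (w (\<lambda>j::nat. if j = 0 then 1 else (0::real))))" for w
  define h where "h s = frag_of s + G (singular_face 1 1 s) - G (singular_face 1 0 s)" for s
  have cX: "cycle c" using singular_cycle_mono[of 1 X V c UNIV] c(1) by simp
  have eq: "c = frag_extend h c" unfolding h_def by (rule cycle_eq_sum_of_based_cycles[OF cX])
  have simplex: "\<exists>p. loop x p \<and> (\<forall>t\<in>{0..1}. p t \<in> V) \<and> cycle (h s) \<and> \<Phi> (h s) = \<Phi> (path_chain p)"
    if "s \<in> Poly_Mapping.keys c" for s
  proof -
    have "singular_simplex 1 ?Y s" using c(1) that by (auto simp: singular_cycle singular_chain_def)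
    then obtain q where q: "pathin ?Y q" "s = path_simplex q" by (rule singular_simplex_1E)
    have qV: "pathin X q" "\<And>t. t \<in> {0..1} \<Longrightarrow> q t \<in> V" using q by (auto simp: pathin_subtopology)
    have g0: "pathin X (g (q 0))" "\<And>t. t \<in> {0..1} \<Longrightarrow> g (q 0) t \<in> V" "g (q 0) 0 = x" "g (q 0) 1 = q 0"
      and g1: "pathin X (g (q 1))" "\<And>t. t \<in> {0..1} \<Longrightarrow> g (q 1) t \<in> V" "g (q 1) 0 = x" "g (q 1) 1 = q 1"
      using g[of "q 0"] g[of "q 1"] qV by (auto simp: pathin_subtopology)
    have hs: "h s = path_chain q + path_chain (g (q 0)) - path_chain (g (q 1))"
      using singular_face_path_simplex[of q] by (simp add: h_def G_def q(2))
    let ?p = "path_join (g (q 0)) (path_join q (\<lambda>t. g (q 1) (1 - t)))"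
    note bc = based_cycle[OF g0(1) qV(1) g1(1) g0(3) g1(3) g0(4) g1(4)]
    have "\<forall>t\<in>{0..1}. ?p t \<in> V"
      unfolding path_join_def using g0(2) g1(2) qV(2) by auto
    then show ?thesis using bc unfolding hs by blast
  qed
  have "\<exists>s\<in>Poly_Mapping.keys c. \<Phi> (h s) \<noteq> \<one>"
  proof (rule ccontr)
    assume "\<not> ?thesis"
    then have "\<Phi> (frag_extend h c) \<in> {\<one>}"
      using simplex by (intro \<Phi>_frag_extend_mem triv_subgroup) auto
    then show False using eq c(2) by simp
  qed
  then show thesis using simplex that by metis
qed

lemma nat_sets_lepoll_if_wild:
  assumes "Metric_space M d" and X: "X = Metric_space.mtopology M d"
    and "compact_space X" "locally_path_connected_space X" "x \<in> topspace X"
    and tf: "torsion_free R"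
    and red: "\<And>a. \<lbrakk>a \<in> carrier R; \<And>n::nat. 0 < n \<Longrightarrow> \<exists>b\<in>carrier R. b [^] n = a\<rbrakk> \<Longrightarrow> a = \<one>"
    and wild: "\<And>W. \<lbrakk>openin X W; x \<in> W\<rbrakk> \<Longrightarrow> \<exists>c. singular_relcycle 1 (subtopology X W) {} c \<and> \<Phi> c \<noteq> \<one>"
  shows "(UNIV :: nat set set) \<lesssim> carrier R"
proof -
  interpret Metric_space M d by fact
  have xM: "x \<in> M" using assms(5) by (simp add: X)
  have complete: mcomplete using assms(3) compact_space_imp_mcomplete by (simp add: X)
  have "\<exists>p. loop x p \<and> (\<forall>t\<in>{0..1}. p t \<in> mball x ((1/2) ^ n)) \<and> \<Phi> (path_chain p) \<noteq> \<one>" for n :: nat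
  proof -
    obtain V where V: "openin X V" "path_connectedin X V" "x \<in> V" "V \<subseteq> mball x ((1/2) ^ n)"
      using assms(4) xM unfolding locally_path_connected_space
      by (metis X centre_in_mball_iff openin_mball zero_less_divide_1_iff zero_less_numeral zero_less_power)
    obtain c where "singular_relcycle 1 (subtopology X V) {} c" "\<Phi> c \<noteq> \<one>" using wild V by blast
    then obtain p where "loop x p" "\<And>t. t \<in> {0..1} \<Longrightarrow> p t \<in> V" "\<Phi> (path_chain p) \<noteq> \<one>"
      using nontrivial_loop[OF V(2,3)] by metis
    then show ?thesis using V(4) by blast
  qed
  then obtain l where l: "\<And>n. loop x (l n)" "\<And>n t. t \<in> {0..1} \<Longrightarrow> l n t \<in> mball x ((1/2) ^ n)"
    "\<And>n. \<Phi> (path_chain (l n)) \<noteq> \<one>" by metis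
  define a where "a n = \<Phi> (path_chain (l n))" for n
  have a: "a n \<in> carrier R" for n unfolding a_def using l \<Phi>_closed cycle_loop by blast
  \<comment> \<open>A nonzero element of a reduced torsion-free group fails to have some root; this
    gives the radix \<open>k n\<close> for the digit \<open>a n\<close>.\<close>
  have "\<exists>k::nat. 0 < k \<and> \<not> (\<exists>b\<in>carrier R. b [^] k = a n)" for n
    using red[of "a n"] a l(3) unfolding a_def by blast
  then obtain k where k: "\<And>n. 0 < (k n :: nat)" "\<And>n. \<not> (\<exists>b\<in>carrier R. b [^] k n = a n)" by metis
  \<comment> \<open>An absent digit is realised by the constant loop, whose class is
    neutral.\<close>
  define L where "L S n = (if n \<in> S then l n else (\<lambda>_. x))" for S and n :: nat
  have L: "loop x (L S n)" for S n using l loop_const assms(5) by (simp add: L_def)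
  have ex: "\<exists>y. (\<forall>n. loop x (y n)) \<and>
      (\<forall>n. \<forall>t\<in>{0..1}. y n t = path_join (L S n) (path_power x (y (Suc n)) (k n)) t)" for S
  proof (rule nested_infinite_concatenation[OF complete xM, of "L S" k])
    show "pathin mtopology (L S n)" "L S n 0 = x" "L S n 1 = x" for n
      using L[of S n] unfolding loop_def by (simp_all add: X)
    show "d x (L S n t) \<le> (1/2) ^ n" if "t \<in> {0..1}" for n t
      using l(2)[OF that, of n] xM by (auto simp: L_def)
    fix y assume "\<And>n. pathin mtopology (y n)" "\<And>n. y n 0 = x" "\<And>n. y n 1 = x"
      "\<And>n t. t \<in> {0..1} \<Longrightarrow> y n t = path_join (L S n) (path_power x (y (Suc n)) (k n)) t"
    then show ?thesis unfolding loop_def unfolding X by blast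
  qed
  define P where "P S y \<longleftrightarrow> (\<forall>n. loop x (y n)) \<and>
      (\<forall>n. \<forall>t\<in>{0..1}. y n t = path_join (L S n) (path_power x (y (Suc n)) (k n)) t)" for S y
  obtain y where y: "\<And>S. P S (y S)" using ex unfolding P_def by metis
  define Y where "Y S n = \<Phi> (path_chain (y S n))" for S n
  have yl: "loop x (y S n)" for S n using y[of S] unfolding P_def by blast
  have step: "Y S n = (if n \<in> S then a n else \<one>) \<otimes> Y S (Suc n) [^] k n" for S n
  proof -
    \<comment> \<open>The two paths are known to agree only on the unit interval, which is all that
      \<open>path_simplex\<close> sees.\<close>
    have "path_simplex (y S n) = path_simplex (path_join (L S n) (path_power x (y S (Suc n)) (k n)))"
      by (rule path_simplex_cong) (use y[of S] in \<open>simp add: P_def\<close>)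
    then have "Y S n = \<Phi> (path_chain (L S n)) \<otimes> \<Phi> (path_chain (path_power x (y S (Suc n)) (k n)))"
      unfolding Y_def by (simp add: \<Phi>_loop_join[OF L loop_power[OF yl]])
    also have "\<dots> = \<Phi> (path_chain (L S n)) \<otimes> Y S (Suc n) [^] k n"
      unfolding Y_def by (simp add: \<Phi>_loop_power[OF yl])
    also have "\<Phi> (path_chain (L S n)) = (if n \<in> S then a n else \<one>)"
      using \<Phi>_loop_const[OF assms(5)] by (simp add: L_def a_def)
    finally show ?thesis .
  qed
  have Yc: "Y S n \<in> carrier R" for S n unfolding Y_def using \<Phi>_closed cycle_loop yl by blast
  have "inj (\<lambda>S. Y S 0)"
    by (rule inj_digit_expansion[OF tf a k Yc step])
  then show ?thesis unfolding lepoll_def using Yc by blast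
qed

section \<open>Locally trivial cycles: finite generation\<close>

text \<open>Each small simplex is completed to a cycle by chains from \<open>b\<close> to its end
  points. The class of the result depends only on the two members of a finite cover chosen for the
  end points, so finitely many classes generate.\<close>

lemma finitely_generated_if_tame:
  assumes "Metric_space M d" and X: "X = Metric_space.mtopology M d"
    and "compact_space X" "path_connected_space X" "locally_path_connected_space X" "b \<in> topspace X"
    and tame: "\<And>x. x \<in> topspace X \<Longrightarrow>
      \<exists>W. openin X W \<and> x \<in> W \<and> (\<forall>c. singular_relcycle 1 (subtopology X W) {} c \<longrightarrow> \<Phi> c = \<one>)"
  shows "\<exists>S. finite S \<and> S \<subseteq> carrier R \<and> generate R S = carrier R"
proof -
  interpret Metric_space M d by fact
  have tX: "topspace X = M" by (simp add: X)
  obtain W where W: "\<And>x. x \<in> M \<Longrightarrow> openin X (W x) \<and> x \<in> W x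
      \<and> (\<forall>c. singular_relcycle 1 (subtopology X (W x)) {} c \<longrightarrow> \<Phi> c = \<one>)"
    using tame unfolding tX by metis
  have "compactin mtopology M" using assms(3) unfolding compact_space_def tX by (simp add: X)
  \<comment> \<open>A Lebesgue number makes triviality uniform: all cycles in a ball of radius
    \<delta> have trivial class.\<close>
  then have "\<exists>\<epsilon>>0. \<forall>x\<in>M. \<exists>U\<in>W ` M. mball x \<epsilon> \<subseteq> U"
    by (rule lebesgue_number) (use W in \<open>auto simp: X\<close>)
  then obtain \<delta> where \<delta>: "0 < \<delta>" "\<And>x. x \<in> M \<Longrightarrow> \<exists>U\<in>W ` M. mball x \<delta> \<subseteq> U" by blast
  have trivial: "\<Phi> c = \<one>" if x: "x \<in> M" and c: "singular_relcycle 1 (subtopology X (mball x \<delta>)) {} c" for x c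
  proof -
    obtain u where "u \<in> M" "mball x \<delta> \<subseteq> W u" using \<delta>(2)[OF x] by blast
    then show ?thesis using W[of u] singular_cycle_mono[OF c] by blast
  qed
  \<comment> \<open>Half of \<delta>, because below every point used is reached from
    \<open>p 0\<close> by passing through at most two cover members, each with mutual distances
    below \<open>e\<close>.\<close>
  define e where "e = \<delta> / 2"
  have e: "0 < e" using \<delta> by (simp add: e_def)
  have "\<exists>U. openin X U \<and> path_connectedin X U \<and> x \<in> U \<and> U \<subseteq> mball x (e / 2)" if "x \<in> M" for x
    using assms(5) that e unfolding locally_path_connected_space
    by (metis X centre_in_mball_iff half_gt_zero openin_mball)
  then obtain U where U: "\<And>x. x \<in> M \<Longrightarrow> openin X (U x) \<and> path_connectedin X (U x) \<and> x \<in> U x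
      \<and> U x \<subseteq> mball x (e / 2)" by metis
  have "\<exists>\<F>. finite \<F> \<and> \<F> \<subseteq> U ` M \<and> topspace X \<subseteq> \<Union>\<F>"
    by (rule compactinD[OF assms(3)[unfolded compact_space_def]]) (use U tX in auto)
  then obtain F where F: "finite F" "F \<subseteq> U ` M" "M \<subseteq> \<Union>F" using tX by auto
  have opF: "openin X V" if "V \<in> F" for V
    using subsetD[OF F(2) that] U by auto
  have cover: "topspace X \<subseteq> \<Union>F" using F(3) by (simp add: tX)
  have close: "d u v < e" if uv: "V \<in> F" "u \<in> V" "v \<in> V" for V u v
  proof -
    obtain x where "x \<in> M" "V = U x" using F(2) uv(1) by blast
    then have "u \<in> mball x (e / 2)" "v \<in> mball x (e / 2)" using U[of x] uv by auto
    then show ?thesis using triangle'[of u x v] by (auto simp: commute)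
  qed
  have pc: "path_connectedin X V" if "V \<in> F" for V using F(2) U that by blast
  have FM: "V \<subseteq> M" if "V \<in> F" for V using pc[OF that] tX by (simp add: path_connectedin_def)
  \<comment> \<open>\<open>I v\<close> is the cover member chosen for the point \<open>v\<close>,
    and \<open>q V\<close> is a hub in the member \<open>V\<close>. Below, \<open>w V\<close> runs
    from \<open>b\<close> to the hub, and \<open>g v\<close> from the hub of \<open>I v\<close> to
    \<open>v\<close> inside \<open>I v\<close>.\<close>
  define I where "I v = (SOME V. V \<in> F \<and> v \<in> V)" for v
  have I: "I v \<in> F \<and> v \<in> I v" if "v \<in> M" for v
    unfolding I_def by (rule someI_ex) (use F(3) that in blast)
  define q where "q V = (SOME v. v \<in> V)" for V :: "'x set"
  have q: "q V \<in> V" if V: "V \<in> F" for V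
  proof -
    obtain x where "x \<in> M" "V = U x" using F(2) V by blast
    then have "x \<in> V" using U by simp
    then show ?thesis unfolding q_def by (rule someI)
  qed
  have "\<exists>p. pathin X p \<and> p 0 = b \<and> p 1 = q V" if "V \<in> F" for V
    using assms(4,6) subsetD[OF FM[OF that] q[OF that]] unfolding path_connected_space_def tX by simp
  then obtain w where w: "\<And>V. V \<in> F \<Longrightarrow> pathin X (w V) \<and> w V 0 = b \<and> w V 1 = q V" by metis
  have "\<exists>p. pathin X p \<and> (\<forall>t\<in>{0..1}. p t \<in> I v) \<and> p 0 = q (I v) \<and> p 1 = v" if "v \<in> M" for v
  proof -
    have "I v \<in> F" "v \<in> I v" using I that by auto
    then show ?thesis
      using pc[of "I v"] q[of "I v"] FM[of "I v"] tX
      unfolding path_connectedin_def path_connected_space_def by (fastforce simp: pathin_subtopology inf_absorb2)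
  qed
  then obtain g where g: "\<And>v. v \<in> M \<Longrightarrow> pathin X (g v) \<and> (\<forall>t\<in>{0..1}. g v t \<in> I v) \<and> g v 0 = q (I v) \<and> g v 1 = v"
    by metis
  define base where "base s = s (\<lambda>j::nat. if j = 0 then 1 else (0::real))" for s :: "(nat \<Rightarrow> real) \<Rightarrow> 'x"
  \<comment> \<open>The connection from \<open>b\<close> stays a sum of a long path, depending only
    on the cover member, and a short one. Thus the long parts cancel literally when two completions
    with equal \<open>K\<close> are subtracted.\<close>
  define G where "G s = path_chain (w (I (base s))) + path_chain (g (base s))" for s
  define h where "h s = frag_of s + G (singular_face 1 1 s) - G (singular_face 1 0 s)" for s
  define T where "T = {s. singular_simplex 1 X s \<and> (\<exists>V\<in>F. s \<in> standard_simplex 1 \<rightarrow> V)}"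
  define K where "K s = (I (base (singular_face 1 1 s)), I (base (singular_face 1 0 s)))" for s
  have T: "\<exists>p V. V \<in> F \<and> pathin X p \<and> (\<forall>t\<in>{0..1}. p t \<in> V) \<and> p 0 \<in> M \<and> p 1 \<in> M \<and> s = path_simplex p
      \<and> h s = path_chain p + (path_chain (w (I (p 0))) + path_chain (g (p 0)))
              - (path_chain (w (I (p 1))) + path_chain (g (p 1)))
      \<and> K s = (I (p 0), I (p 1))" if sT: "s \<in> T" for s
  proof -
    obtain V where V: "V \<in> F" "s \<in> standard_simplex 1 \<rightarrow> V" and s: "singular_simplex 1 X s"
      using sT unfolding T_def by blast
    have "singular_simplex 1 (subtopology X V) s"
      using s V(2) unfolding singular_simplex_subtopology by blast
    then obtain p where p: "pathin (subtopology X V) p" "s = path_simplex p" by (rule singular_simplex_1E)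
    have pV: "pathin X p" "\<forall>t\<in>{0..1}. p t \<in> V" using p by (simp_all add: pathin_subtopology)
    have "p 0 \<in> M" "p 1 \<in> M" using pV(2) FM[OF V(1)] by auto
    then show ?thesis
      using p(2) pV V(1) singular_face_path_simplex[of p] unfolding h_def G_def K_def base_def
      by (intro exI[of _ p] exI[of _ V]) simp
  qed
  have h_cycle: "cycle (h s)" if sT: "s \<in> T" for s
  proof -
    obtain p where p: "pathin X p" "p 0 \<in> M" "p 1 \<in> M"
      and hs: "h s = path_chain p + (path_chain (w (I (p 0))) + path_chain (g (p 0)))
              - (path_chain (w (I (p 1))) + path_chain (g (p 1)))" using T[OF sT] by blast
    have "chain_boundary 1 (h s) = 0"
      unfolding hs chain_boundary_add chain_boundary_diff chain_boundary_path_simplex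
      using p I w g by simp
    then show ?thesis
      unfolding singular_cycle hs
      by (intro conjI singular_chain_diff singular_chain_add singular_chain_path) (use p I w g in auto)
  qed
  have sub_chain: "singular_chain 1 (subtopology X B) (path_chain r)"
    if "pathin X r" "\<And>t. t \<in> {0..1} \<Longrightarrow> r t \<in> B" for r B
    using singular_simplex_path_simplex[of "subtopology X B" r] that
    by (simp add: singular_chain_of pathin_subtopology)
  have factor: "\<Phi> (h s) = \<Phi> (h s')" if s: "s \<in> T" and s': "s' \<in> T" and K: "K s = K s'" for s s'
  proof -
    obtain p V where p: "V \<in> F" "pathin X p" "\<And>t. t \<in> {0..1} \<Longrightarrow> p t \<in> V" "p 0 \<in> M" "p 1 \<in> M"
      and hs: "h s = path_chain p + (path_chain (w (I (p 0))) + path_chain (g (p 0)))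
              - (path_chain (w (I (p 1))) + path_chain (g (p 1)))" "K s = (I (p 0), I (p 1))"
      using T[OF s] by blast
    obtain p' V' where p': "V' \<in> F" "pathin X p'" "\<And>t. t \<in> {0..1} \<Longrightarrow> p' t \<in> V'" "p' 0 \<in> M" "p' 1 \<in> M"
      and hs': "h s' = path_chain p' + (path_chain (w (I (p' 0))) + path_chain (g (p' 0)))
              - (path_chain (w (I (p' 1))) + path_chain (g (p' 1)))" "K s' = (I (p' 0), I (p' 1))"
      using T[OF s'] by blast
    have I_eq: "I (p' 0) = I (p 0)" "I (p' 1) = I (p 1)" using K hs(2) hs'(2) by auto
    have diff: "h s - h s' = path_chain p + path_chain (g (p 0)) - path_chain (g (p 1))
        - (path_chain p' + path_chain (g (p' 0)) - path_chain (g (p' 1)))"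
      unfolding hs(1) hs'(1) I_eq by simp
    \<comment> \<open>What remains of the difference lies in this ball. The paths of
      \<open>s\<close> stay in cover members containing \<open>p 0\<close> or \<open>p 1\<close>;
      those of \<open>s'\<close> are tied to them because the members chosen for the end points
      coincide.\<close>
    let ?B = "mball (p 0) \<delta>"
    have ball: "v \<in> ?B" if "A \<in> F" "u \<in> A" "v \<in> A" "u \<in> M" "d (p 0) u < e" for A u v
    proof -
      have "v \<in> M" using FM that by blast
      then have "d (p 0) v < \<delta>"
        using triangle[of "p 0" u v] close[OF that(1-3)] p(4) that(4,5) by (simp add: e_def)
      then show ?thesis using p(4) \<open>v \<in> M\<close> by simp
    qed
    have d0: "d (p 0) (p 0) < e" using p(4) e by simp
    have d1: "d (p 0) (p 1) < e" using close[OF p(1)] p(3) by simp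
    have d0': "d (p 0) (p' 0) < e" using close[of "I (p 0)" "p 0" "p' 0"] I[OF p(4)] I[OF p'(4)] I_eq by simp
    have "singular_chain 1 (subtopology X ?B) (h s - h s')"
      unfolding diff
    proof (intro singular_chain_diff singular_chain_add sub_chain)
      show "p t \<in> ?B" if "t \<in> {0..1}" for t
        by (rule ball[OF p(1) _ _ p(4) d0]) (use p(3) that in auto)
      show "g (p 0) t \<in> ?B" if "t \<in> {0..1}" for t
        by (rule ball[of "I (p 0)", OF _ _ _ p(4) d0]) (use I[OF p(4)] g[OF p(4)] that in auto)
      show "g (p 1) t \<in> ?B" if "t \<in> {0..1}" for t
        by (rule ball[of "I (p 1)", OF _ _ _ p(5) d1]) (use I[OF p(5)] g[OF p(5)] that in auto)
      show "p' t \<in> ?B" if "t \<in> {0..1}" for t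
        by (rule ball[OF p'(1) _ _ p'(4) d0']) (use p'(3) that in auto)
      show "g (p' 0) t \<in> ?B" if "t \<in> {0..1}" for t
        by (rule ball[of "I (p' 0)", OF _ _ _ p'(4) d0']) (use I[OF p'(4)] g[OF p'(4)] that in auto)
      show "g (p' 1) t \<in> ?B" if "t \<in> {0..1}" for t
        by (rule ball[of "I (p' 1)", OF _ _ _ p(5) d1])
          (use I[OF p'(5)] I[OF p(5)] g[OF p'(5)] that I_eq in auto)
    qed (use p p' g in auto)
    moreover have "chain_boundary 1 (h s - h s') = 0"
      using h_cycle[OF s] h_cycle[OF s'] by (simp only: singular_cycle chain_boundary_diff) simp
    ultimately have "\<Phi> (h s - h s') = \<one>"
      using trivial[OF p(4)] by (simp only: singular_cycle simp_thms)
    then show ?thesis using \<Phi>_eqI h_cycle s s' by blast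
  qed
  define S where "S = (\<lambda>s. \<Phi> (h s)) ` T"
  have "finite (K ` T)"
  proof (rule finite_subset)
    show "K ` T \<subseteq> F \<times> F" using T I by fastforce
  qed (use F(1) in simp)
  then have "finite S" unfolding S_def by (rule finite_image_factor) (rule factor)
  moreover have SR: "S \<subseteq> carrier R" unfolding S_def using \<Phi>_closed h_cycle by blast
  moreover have "carrier R \<subseteq> generate R S"
  proof
    fix a assume "a \<in> carrier R"
    then obtain c where c: "cycle c" "a = \<Phi> c" using onto by blast
    \<comment> \<open>Subdivision: a homologous cycle all of whose simplices lie in members of
      \<open>F\<close>, hence in \<open>T\<close>.\<close>
    obtain c' where c': "cycle c'" "homologous_rel 1 X {} c c'"
      "\<And>f. f \<in> Poly_Mapping.keys c' \<Longrightarrow> \<exists>V\<in>F. f \<in> standard_simplex 1 \<rightarrow> V"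
    proof (rule small_homologous_rel_relcycle_exists[OF opF cover c(1)])
      fix c' assume "cycle c'" "homologous_rel 1 X {} c c'"
        "\<And>f. f \<in> Poly_Mapping.keys c' \<Longrightarrow> \<exists>V\<in>F. f \<in> standard_simplex 1 \<rightarrow> V"
      then show thesis by (rule that)
    qed
    have "a = \<Phi> c'" using \<Phi>_eqI[OF c(1) c'(1)] boundary c'(2) c(2) by (simp add: homologous_rel_def)
    also have "c' = frag_extend h c'" unfolding h_def by (rule cycle_eq_sum_of_based_cycles[OF c'(1)])
    also have "\<Phi> (frag_extend h c') \<in> generate R S"
    proof (rule \<Phi>_frag_extend_mem)
      show "subgroup (generate R S) R" by (rule generate_is_subgroup[OF SR])
      fix s assume "s \<in> Poly_Mapping.keys c'"
      then have "s \<in> T" using c'(1,3) unfolding T_def singular_cycle singular_chain_def by blast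
      then show "cycle (h s) \<and> \<Phi> (h s) \<in> generate R S"
        using h_cycle generate.incl[of "\<Phi> (h s)" S R] by (auto simp: S_def)
    qed
    finally show "a \<in> generate R S" .
  qed
  ultimately show ?thesis using generate_incl[OF SR] by blast
qed

end

section \<open>Cardinality of the group of chains\<close>

text \<open>A sequence of sets of naturals is coded by a single set of encoded pairs.\<close>

lemma nat_fun_lepoll_nat_sets:
  assumes "A \<lesssim> (UNIV :: nat set set)"
  shows "{f :: nat \<Rightarrow> 'a. range f \<subseteq> A} \<lesssim> (UNIV :: nat set set)"
proof -
  obtain e :: "'a \<Rightarrow> nat set" where e: "inj_on e A" using assms by (auto simp: lepoll_def)
  define E where "E f = {prod_encode (i, j) |i j. j \<in> e (f i)}" for f
  have mem: "prod_encode (i, j) \<in> E f \<longleftrightarrow> j \<in> e (f i)" for f i j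
    by (auto simp: E_def)
  have "inj_on E {f. range f \<subseteq> A}"
  proof (rule inj_onI, rule ext)
    fix f g i assume fg: "f \<in> {f. range f \<subseteq> A}" "g \<in> {f. range f \<subseteq> A}" "E f = E g"
    then have "e (f i) = e (g i)" using mem by blast
    then show "f i = g i" using fg(1,2) inj_onD[OF e, of "f i" "g i"] by (auto simp: image_subset_iff)
  qed
  then show ?thesis unfolding lepoll_def by blast
qed

text \<open>Total boundedness yields a countable dense set, and a point is determined by the
  sequence of its distances to that set.\<close>

lemma compact_metric_lepoll_nat_sets:
  assumes "Metric_space M d" and comp: "compact_space (Metric_space.mtopology M d)"
  shows "M \<lesssim> (UNIV :: nat set set)"
proof -
  interpret Metric_space M d by fact
  have "mtotally_bounded M"
    using comp compactin_imp_mtotally_bounded[of M] by (simp add: compact_space_def)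
  then have "\<exists>K. finite K \<and> K \<subseteq> M \<and> M \<subseteq> (\<Union>x\<in>K. mball x ((1/2) ^ n))" for n :: nat
    unfolding mtotally_bounded_def by simp
  then obtain K where K: "\<And>n::nat. finite (K n) \<and> K n \<subseteq> M \<and> M \<subseteq> (\<Union>x\<in>K n. mball x ((1/2) ^ n))" by metis
  define D where "D = (\<Union>n. K n)"
  have D: "countable D" "D \<subseteq> M" using K unfolding D_def by (auto intro: countable_finite)
  show ?thesis
  proof (cases "M = {}")
    case False
    then have "D \<noteq> {}" using K[of 0] unfolding D_def by fastforce
    define r where "r = from_nat_into D"
    have r: "range r = D" unfolding r_def using D(1) \<open>D \<noteq> {}\<close> by (rule range_from_nat_into[rotated])
    have "inj_on (\<lambda>x n. d x (r n)) M"
    proof (rule inj_onI, rule ccontr)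
      fix x y assume xy: "x \<in> M" "y \<in> M" "(\<lambda>n. d x (r n)) = (\<lambda>n. d y (r n))" "x \<noteq> y"
      then have "0 < d x y / 2" by simp
      then obtain n :: nat where n: "(1/2) ^ n < d x y / 2" using real_arch_pow_inv[of "d x y / 2" "1/2"] by auto
      obtain z where z: "z \<in> K n" "x \<in> mball z ((1/2) ^ n)" using K[of n] xy(1) by blast
      then obtain m where "z = r m" using r unfolding D_def by blast
      then have "d x z = d y z" using fun_cong[OF xy(3), of m] by simp
      then show False using triangle'[of x z y] z n xy(1,2) by (auto simp: commute)
    qed
    then have "M \<lesssim> {f :: nat \<Rightarrow> real. range f \<subseteq> UNIV}" unfolding lepoll_def by blast
    also have "\<dots> \<lesssim> (UNIV :: nat set set)"
      using nat_fun_lepoll_nat_sets[of "UNIV :: real set"] nat_sets_eqpoll_reals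
        eqpoll_imp_lepoll eqpoll_sym by blast
    finally show ?thesis .
  qed (simp add: lepoll_def)
qed

text \<open>A path in a Hausdorff space is determined by its values at the rational parameters,
  hence by a sequence of points.\<close>

lemma singular_simplex_1_lepoll_nat_sets:
  assumes "Hausdorff_space X" "topspace X \<lesssim> (UNIV :: nat set set)"
  shows "singular_simplex_set 1 X \<lesssim> (UNIV :: nat set set)"
proof -
  obtain P where P: "\<And>s. s \<in> singular_simplex_set 1 X \<Longrightarrow> pathin X (P s) \<and> s = path_simplex (P s)"
    using singular_simplex_1E by (metis mem_Collect_eq)
  define Q where "Q = \<rat> \<inter> {0..1::real}"
  have Q: "countable Q" "Q \<noteq> {}" using countable_rat by (auto simp: Q_def)
  define r where "r = from_nat_into Q"
  have r: "range r = Q" unfolding r_def using Q by (simp add: range_from_nat_into)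
  have dense: "t \<in> subtopology euclideanreal {0..1} closure_of Q" if t: "t \<in> {0..1}" for t
    unfolding in_closure_of
  proof (intro conjI allI impI)
    fix T assume "t \<in> T \<and> openin (subtopology euclideanreal {0..1}) T"
    then obtain e where e: "0 < e" "\<And>u. \<lbrakk>u \<in> {0..1}; dist u t < e\<rbrakk> \<Longrightarrow> u \<in> T"
      unfolding openin_euclidean_subtopology_iff by blast
    \<comment> \<open>Clipping at 0 and 1 keeps \<open>u\<close> in the unit interval, also when
      \<open>t\<close> is one of its end points.\<close>
    obtain u where "u \<in> \<rat>" "max 0 (t - e) < u" "u < min 1 (t + e)"
      using Rats_dense_in_real[of "max 0 (t - e)" "min 1 (t + e)"] e(1) t by auto
    then show "\<exists>u. u \<in> Q \<and> u \<in> T" using e(2)[of u] by (auto simp: Q_def dist_real_def)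
  qed (use t in simp)
  have "inj_on (\<lambda>s n. P s (r n)) (singular_simplex_set 1 X)"
  proof (rule inj_onI)
    fix s s' assume s: "s \<in> singular_simplex_set 1 X" "s' \<in> singular_simplex_set 1 X"
      and eq: "(\<lambda>n. P s (r n)) = (\<lambda>n. P s' (r n))"
    have "P s t = P s' t" if "t \<in> {0..1}" for t
    proof (rule forall_in_closure_of_eq[of t "subtopology euclideanreal {0..1}" Q X])
      show "P s x = P s' x" if "x \<in> Q" for x using that r fun_cong[OF eq] by (metis imageE)
    qed (use P[OF s(1)] P[OF s(2)] dense that assms(1) in \<open>auto simp: pathin_def\<close>)
    then show "s = s'" using P[OF s(1)] P[OF s(2)] path_simplex_cong by metis
  qed
  moreover have "P s (r n) \<in> topspace X" if "s \<in> singular_simplex_set 1 X" for s n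
  proof -
    have "r n \<in> {0..1}" using r by (auto simp: Q_def)
    then show ?thesis using path_image_subset_topspace[of X "P s"] P[OF that] by auto
  qed
  ultimately have "singular_simplex_set 1 X \<lesssim> {f :: nat \<Rightarrow> _. range f \<subseteq> topspace X}"
    unfolding lepoll_def by (intro exI[of _ "\<lambda>s n. P s (r n)"]) auto
  also have "\<dots> \<lesssim> (UNIV :: nat set set)" by (rule nat_fun_lepoll_nat_sets[OF assms(2)])
  finally show ?thesis .
qed

text \<open>A finitely supported integer function is coded by its graph over the support, a finite
  subset of \<open>A \<times> UNIV\<close>; an infinite set has only as many finite subsets as
  elements.\<close>

lemma free_Abelian_group_lepoll_nat_sets:
  assumes "A \<lesssim> (UNIV :: nat set set)"
  shows "carrier (free_Abelian_group A) \<lesssim> (UNIV :: nat set set)"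
proof -
  have "carrier (free_Abelian_group A) \<lesssim> {f::'a\<Rightarrow>int. f ` A \<subseteq> UNIV \<and> {x. f x \<noteq> 0} \<subseteq> A \<and> finite {x. f x \<noteq> 0}}"
    unfolding lepoll_def
    by (rule exI[of _ Poly_Mapping.lookup]) (auto simp: poly_mapping_eqI lookup_not_eq_zero_eq_in_keys inj_onI)
  also have "\<dots> \<lesssim> Fpow (A \<times> (UNIV::int set))"
    by (rule lepoll_restricted_funspace)
  \<comment> \<open>\<open>A\<close> may be empty; replacing it by the collection of all sets of
    naturals makes the product infinite, so that its finite subsets can be counted.\<close>
  also have "\<dots> \<lesssim> Fpow ((UNIV :: nat set set) \<times> (UNIV :: int set))"
  proof -
    have "A \<times> (UNIV::int set) \<lesssim> (UNIV :: nat set set) \<times> (UNIV :: int set)"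
      using assms by (rule times_lepoll_mono) simp
    then obtain f where f: "inj_on f (A \<times> (UNIV::int set))" "f ` (A \<times> UNIV) \<subseteq> (UNIV :: nat set set) \<times> (UNIV :: int set)"
      by (auto simp: lepoll_def)
    have "inj_on ((`) f) (Fpow (A \<times> (UNIV::int set)))" by (rule inj_on_image_Fpow[OF f(1)])
    moreover have "((`) f) ` Fpow (A \<times> (UNIV::int set)) \<subseteq> Fpow ((UNIV :: nat set set) \<times> (UNIV :: int set))"
      by (auto simp: Fpow_def)
    ultimately show ?thesis unfolding lepoll_def by blast
  qed
  also have "\<dots> \<approx> (UNIV :: nat set set) \<times> (UNIV :: int set)"
    using finite_cartesian_productD2[of "UNIV :: nat set set" "UNIV :: int set"] infinite_UNIV_int
    by (intro eqpoll_Fpow) auto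
  also have "\<dots> \<lesssim> (UNIV :: nat set set)"
  proof -
    have "inj (\<lambda>i. {int_encode i})" by (auto intro!: injI dest: injD[OF inj_int_encode])
    then have "(UNIV :: int set) \<lesssim> (UNIV :: nat set set)" unfolding lepoll_def by blast
    then have "|UNIV :: int set| \<le>o |UNIV :: nat set set|" unfolding lepoll_def card_of_ordLeq .
    then have "|(UNIV :: nat set set) \<times> (UNIV :: int set)| \<le>o |UNIV :: nat set set|"
      by (intro card_of_Times_ordLeq_infinite) (auto simp: Finite_Set.finite_set)
    then show ?thesis unfolding lepoll_def card_of_ordLeq .
  qed
  finally show ?thesis .
qed

section \<open>The reduced part of the first homology group\<close>

text \<open>\<Phi> is the composite of three projections: modulo boundaries, modulo torsion, and
  modulo the maximal divisible subgroup.\<close>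

lemma homology_reduced_cycle_hom:
  fixes X :: "'x topology"
  defines "H \<equiv> homology_group 1 X"
  defines "A \<equiv> H Mod (torsion_subgroup H)"
  obtains \<Phi> where "cycle_hom (reduced_part A) X \<Phi>"
    and "torsion_free (reduced_part A)"
    and "\<And>x. \<lbrakk>x \<in> carrier (reduced_part A);
      \<And>n::nat. 0 < n \<Longrightarrow> \<exists>y\<in>carrier (reduced_part A). y [^]\<^bsub>reduced_part A\<^esub> n = x\<rbrakk> \<Longrightarrow> x = \<one>\<^bsub>reduced_part A\<^esub>"
proof -
  let ?Z = "relcycle_group 1 X {}" and ?B = "singular_relboundary_set 1 X {}"
  have HZ: "H = ?Z Mod ?B" using nontrivial_relative_homology_group[of 1 X "{}"] by (simp add: H_def)
  interpret Z: comm_group ?Z by (rule abelian_relcycle_group)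
  have B: "subgroup ?B ?Z" by (rule subgroup_singular_relboundary_relcycle)
  interpret H: comm_group H unfolding HZ by (rule Z.comm_group_FactGroup[OF B])
  interpret A: comm_group A unfolding A_def by (rule H.comm_group_FactGroup[OF H.subgroup_torsion])
  have tfA: "torsion_free A" unfolding A_def by (rule H.torsion_free_Mod_torsion)
  let ?R = "reduced_part A"
  note R = A.reduced_part_torsion_free[OF tfA]
  interpret R: comm_group ?R by (rule R(1))
  define f1 f2 f3 where "f1 = (\<lambda>c. ?B #>\<^bsub>?Z\<^esub> c)" and "f2 = (\<lambda>c. torsion_subgroup H #>\<^bsub>H\<^esub> c)"
    and "f3 = (\<lambda>c. max_divisible_subgroup A #>\<^bsub>A\<^esub> c)"
  have f1: "f1 \<in> hom ?Z H" "f1 ` carrier ?Z = carrier H" "c \<in> ?B \<Longrightarrow> f1 c = \<one>\<^bsub>H\<^esub>" for c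
    using Z.rcoset_hom_FactGroup[OF B] subgroup.mem_carrier[OF B] unfolding f1_def HZ by auto
  have f2: "f2 \<in> hom H A" "f2 ` carrier H = carrier A"
    using H.rcoset_hom_FactGroup[OF H.subgroup_torsion] unfolding f2_def A_def by auto
  have f3: "f3 \<in> hom A ?R" "f3 ` carrier A = carrier ?R" using R(2,3) unfolding f3_def by auto
  have "cycle_hom ?R X (f3 \<circ> (f2 \<circ> f1))"
  proof (intro cycle_hom.intro cycle_hom_axioms.intro R(1))
    show "f3 \<circ> (f2 \<circ> f1) \<in> hom ?Z ?R" using f1(1) f2(1) f3(1) by (intro hom_compose)
    show "(f3 \<circ> (f2 \<circ> f1)) ` singular_relcycle_set 1 X {} = carrier ?R"
      by (simp only: image_comp[symmetric] f1(2)[unfolded carrier_relcycle_group] f2(2) f3(2))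
    fix c assume "singular_relboundary 1 X {} c"
    then have "f1 c = \<one>\<^bsub>H\<^esub>" using f1(3) by simp
    moreover have "f2 \<one>\<^bsub>H\<^esub> = \<one>\<^bsub>A\<^esub>" "f3 \<one>\<^bsub>A\<^esub> = \<one>\<^bsub>?R\<^esub>"
      using f2(1) f3(1) hom_one[OF _ H.is_group A.is_group] hom_one[OF _ A.is_group R.is_group] by auto
    ultimately show "(f3 \<circ> (f2 \<circ> f1)) c = \<one>\<^bsub>?R\<^esub>" by simp
  qed
  then show thesis using that R(4,5) by blast
qed

theorem theorem3p5:
  fixes X :: "'a topology"
  assumes "peano_continuum X"
  defines "H \<equiv> homology_group 1 X"
  defines "A \<equiv> H Mod (torsion_subgroup H)"
  shows "free_abelian_finite_rank (reduced_part A)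
         \<or> carrier (reduced_part A) \<approx> (UNIV :: real set)"
proof -
  let ?R = "reduced_part A"
  obtain \<Phi> where "cycle_hom ?R X \<Phi>" and tf: "torsion_free ?R"
    and red: "\<And>x. \<lbrakk>x \<in> carrier ?R; \<And>n::nat. 0 < n \<Longrightarrow> \<exists>y\<in>carrier ?R. y [^]\<^bsub>?R\<^esub> n = x\<rbrakk> \<Longrightarrow> x = \<one>\<^bsub>?R\<^esub>"
    unfolding A_def H_def using homology_reduced_cycle_hom[of X] by metis
  interpret cycle_hom ?R X \<Phi> by fact
  have X: "path_connected_space X" "locally_path_connected_space X" "compact_space X" "metrizable_space X"
    using assms(1) by (auto simp: peano_continuum_def)
  then obtain M d where M: "Metric_space M d" "X = Metric_space.mtopology M d"
    unfolding metrizable_space_def by blast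
  have tX: "topspace X = M" using M Metric_space.topspace_mtopology by metis
  show ?thesis
  proof (cases "\<exists>x\<in>topspace X. \<forall>W. openin X W \<and> x \<in> W
      \<longrightarrow> (\<exists>c. singular_relcycle 1 (subtopology X W) {} c \<and> \<Phi> c \<noteq> \<one>\<^bsub>?R\<^esub>)")
    case True
    then have lower: "(UNIV :: nat set set) \<lesssim> carrier ?R"
      using nat_sets_lepoll_if_wild[OF M X(3,2) _ tf red] by blast
    \<comment> \<open>Upper bound: the reduced part is an image of the cycles, which are finite
      integer combinations of singular simplices.\<close>
    have "singular_simplex_set 1 X \<lesssim> (UNIV :: nat set set)"
      using compact_metric_lepoll_nat_sets[OF M(1)] X M tX metrizable_imp_Hausdorff_space
      by (intro singular_simplex_1_lepoll_nat_sets) auto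
    then have "carrier (free_Abelian_group (singular_simplex_set 1 X)) \<lesssim> (UNIV :: nat set set)"
      by (rule free_Abelian_group_lepoll_nat_sets)
    moreover have "singular_relcycle_set 1 X {} \<subseteq> carrier (free_Abelian_group (singular_simplex_set 1 X))"
      by (auto simp: singular_cycle singular_chain_def)
    ultimately have "singular_relcycle_set 1 X {} \<lesssim> (UNIV :: nat set set)"
      by (rule lepoll_trans[OF subset_imp_lepoll, rotated])
    moreover have "carrier ?R \<lesssim> singular_relcycle_set 1 X {}"
      unfolding onto[symmetric] by (rule image_lepoll)
    ultimately have "carrier ?R \<lesssim> (UNIV :: nat set set)" by (rule lepoll_trans[rotated])
    then have "carrier ?R \<approx> (UNIV :: nat set set)" using lower by (rule lepoll_antisym)
    then show ?thesis using nat_sets_eqpoll_reals eqpoll_trans by blast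
  next
    case tame: False
    have "\<exists>S. finite S \<and> S \<subseteq> carrier ?R \<and> generate ?R S = carrier ?R"
    \<comment> \<open>\<open>path_connected_space\<close> admits the empty space, which offers no
      base point; there the zero chain is the only cycle.\<close>
    proof (cases "topspace X = {}")
      case True
      then have "singular_relcycle_set 1 X {} = {0}" by (auto simp: singular_cycle singular_chain_empty)
      then have "carrier ?R = {\<one>\<^bsub>?R\<^esub>}" using onto \<Phi>_zero by simp
      then show ?thesis using generate_empty by (intro exI[of _ "{}"]) simp
    next
      case False
      then obtain b where "b \<in> topspace X" by blast
      then show ?thesis
      proof (rule finitely_generated_if_tame[OF M X(3,1,2)])
        show "\<exists>W. openin X W \<and> x \<in> W \<and> (\<forall>c. singular_relcycle 1 (subtopology X W) {} c \<longrightarrow> \<Phi> c = \<one>\<^bsub>?R\<^esub>)"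
          if x: "x \<in> topspace X" for x
        proof -
          obtain W where "openin X W" "x \<in> W"
            "\<not> (\<exists>c. singular_relcycle 1 (subtopology X W) {} c \<and> \<Phi> c \<noteq> \<one>\<^bsub>?R\<^esub>)"
            using tame x by meson
          then show ?thesis by blast
        qed
      qed
    qed
    then show ?thesis using finitely_generated_torsion_free_imp_free[OF tf] by blast
  qed
qed

end
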